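(* Let $(\mathbf E,\mathbf R)$ be a representation of a quiver $\mathbf Q=\{A\rightrightarrows^s_t V\}$ and let $k\in\{1,2,3,\ldots\}$. For every $v\in V$ let $L_v:E_v\to E_v$ be a linear map and $F_v:E_v\to E_v$ a $C^k$ map with $F_v(0)=0$ and $DF_v(0)=L_v$, such that $$R_a\circ L_{s(a)}=L_{t(a)}\circ R_a\quad\text{and}\quad R_a\circ F_{s(a)}=F_{t(a)}\circ R_a\quad\text{for all } a\in A .$$ Assume moreover that for every $v\in V$ $$\sup_{x\in E_v}\|D^\alpha(F_v(x)-L_vx)\|<\infty\ \text{ for all } |\alpha|\le k\quad\text{and}\quad \sup_{x\in E_v}\|DF_v(x)-L_v\|<\varepsilon(L_v,k),$$ where $\varepsilon(L_v,k)>0$ is the constant of the classical global center manifold theorem (recalled in the context), so that each $F_v$ admits a unique global center manifold $M_v^c$. Then $R_a(M^c_{s(a)})\subset M^c_{t(a)}$ for all $a\in A$. Moreover, the center manifold reductions $F_v^c:E_v^c\to E_v^c$ ($v\in V$) satisfy $$R_a\circ F^c_{s(a)}=F^c_{t(a)}\circ R_a\quad\text{on } E^c_{s(a)},\ \text{for all } a\in A .$$ So the $F_v^c$ define a $\mathbf Q$-equivariant vector field on the subrepresentation $\mathbf E^c$ of $(\mathbf E,\mathbf R)$ consisting of the center subspaces $E_v^c$ ($v\in V$).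
   Context: A quiver $\mathbf Q=\{A\rightrightarrows^s_t V\}$ is a directed multigraph with a finite set $A$ of arrows, a finite set $V$ of vertices, a source map $s:A\to V$ and a target map $t:A\to V$. A representation $(\mathbf E,\mathbf R)$ of $\mathbf Q$ consists of a finite dimensional real vector space $E_v$ for each $v\in V$ and a linear map $R_a:E_{s(a)}\to E_{t(a)}$ for each $a\in A$. A subrepresentation is a choice of linear subspaces $D_v\subset E_v$ with $R_a(D_{s(a)})\subset D_{t(a)}$ for all $a\in A$. A family of maps $F_v:E_v\to E_v$ ($v\in V$) is $\mathbf Q$-equivariant if $F_{t(a)}\circ R_a=R_a\circ F_{s(a)}$ for all $a\in A$. Center and hyperbolic subspaces. For a linear map $L:E\to E$ on a finite dimensional real vector space, $E^c$ is the sum of the (real) generalised eigenspaces of $L$ for eigenvalues on the imaginary axis, and $E^h$ is the sum of the (real) generalised eigenspaces for eigenvalues not on the imaginary axis; $\pi^c:E=E^c\oplus E^h\to E^c$ and $\pi^h=1-\pi^c:E\to E^h$ are the corresponding projections. Classical global center manifold theorem (known fact, used to define the objects). Given $L:E\to E$ linear and $k\ge 1$ there is an $\varepsilon=\varepsilon(L,k)>0$ such that the following holds. If $F:E\to E$ is a $C^k$ vector field with $F(0)=0$, $DF(0)=L$, $\sup_{x\in E}\|D^\alpha(F(x)-Lx)\|<\infty$ for all $|\alpha|\le k$ and $\sup_{x\in E}\|DF(x)-L\|<\varepsilon$, then there is a $C^k$ map $\phi:E^c\to E^h$ with $\phi(0)=0$, $D\phi(0)=0$, whose graph $M^c:=\{x^c+\phi(x^c)\mid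 x^c\in E^c\}$ is an invariant manifold for the flow $e^{tF}$ of $\frac{dx}{dt}=F(x)$, and moreover $M^c=\{x\in E\mid \sup_{t\in\mathbb R}\|(\pi^h\circ e^{tF})(x)\|<\infty\}$. This $M^c$ is called the global center manifold of $F$. The center manifold reduction of $F$ is the vector field $F^c:E^c\to E^c$, $F^c(x^c):=(\pi^c\circ F)(x^c+\phi(x^c))$. Applied to $E_v,L_v,F_v$ this defines $E_v^c,E_v^h,\phi_v,M_v^c,F_v^c$. *)

theory Defs
  imports "HOL-Analysis.Analysis" "Graph_Theory.Digraph"
begin

text \<open>
  Finite dimensional real vector spaces of varying dimension are modelled as linear subspaces
  of one Euclidean space, with the induced norm. Maps between them are total functions of
  which only the values on the relevant subspace matter.
\<close>

definition linear_map_on ::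
  "'e::real_vector set \<Rightarrow> 'f::real_vector set \<Rightarrow> ('e \<Rightarrow> 'f) \<Rightarrow> bool" where
  "linear_map_on D E f \<longleftrightarrow> f \<in> D \<rightarrow> E \<and>
     (\<forall>x\<in>D. \<forall>y\<in>D. f (x + y) = f x + f y) \<and> (\<forall>c. \<forall>x\<in>D. f (c *\<^sub>R x) = c *\<^sub>R f x)"


section \<open>Quiver representations\<close>

text \<open>A quiver is a \<open>fin_digraph\<close> (loops and parallel arcs are allowed there); its source map
  is \<^const>\<open>tail\<close> and its target map is \<^const>\<open>head\<close>.\<close>

definition quiver_representation ::
  "('v, 'a) pre_digraph \<Rightarrow> ('v \<Rightarrow> 'e::euclidean_space set) \<Rightarrow> ('a \<Rightarrow> 'e \<Rightarrow> 'e) \<Rightarrow> bool" where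
  "quiver_representation Q E R \<longleftrightarrow> (\<forall>v\<in>verts Q. subspace (E v)) \<and>
     (\<forall>a\<in>arcs Q. linear_map_on (E (tail Q a)) (E (head Q a)) (R a))"

definition subrepresentation ::
  "('v, 'a) pre_digraph \<Rightarrow> ('v \<Rightarrow> 'e::euclidean_space set) \<Rightarrow> ('a \<Rightarrow> 'e \<Rightarrow> 'e) \<Rightarrow> ('v \<Rightarrow> 'e set) \<Rightarrow> bool"
  where
  "subrepresentation Q E R D \<longleftrightarrow> (\<forall>v\<in>verts Q. subspace (D v) \<and> D v \<subseteq> E v) \<and>
     (\<forall>a\<in>arcs Q. R a ` D (tail Q a) \<subseteq> D (head Q a))"

definition equivariant ::
  "('v, 'a) pre_digraph \<Rightarrow> ('v \<Rightarrow> 'e::euclidean_space set) \<Rightarrow> ('a \<Rightarrow> 'e \<Rightarrow> 'e) \<Rightarrow> ('v \<Rightarrow> 'e \<Rightarrow> 'e) \<Rightarrow> bool"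
  where
  "equivariant Q E R F \<longleftrightarrow> (\<forall>v\<in>verts Q. F v \<in> E v \<rightarrow> E v) \<and>
     (\<forall>a\<in>arcs Q. \<forall>x\<in>E (tail Q a). R a (F (tail Q a) x) = F (head Q a) (R a x))"


section \<open>Center and hyperbolic subspaces\<close>

text \<open>The operator \<open>L - \<mu>\<close> on the complexification of the domain of \<open>L\<close>, with the pair
  \<open>(x, y)\<close> standing for \<open>x + \<i> y\<close>.\<close>

definition complexified_minus :: "('e::real_vector \<Rightarrow> 'e) \<Rightarrow> complex \<Rightarrow> 'e \<times> 'e \<Rightarrow> 'e \<times> 'e" where
  "complexified_minus L \<mu> w =
     (L (fst w) - Re \<mu> *\<^sub>R fst w + Im \<mu> *\<^sub>R snd w, L (snd w) - Re \<mu> *\<^sub>R snd w - Im \<mu> *\<^sub>R fst w)"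

definition complex_eigenvalue :: "'e::real_vector set \<Rightarrow> ('e \<Rightarrow> 'e) \<Rightarrow> complex \<Rightarrow> bool" where
  "complex_eigenvalue E L \<mu> \<longleftrightarrow> (\<exists>w\<in>E \<times> E. w \<noteq> 0 \<and> complexified_minus L \<mu> w = 0)"

text \<open>The real parts of the complex generalised eigenvectors for \<open>\<mu>\<close>. Imaginary parts are
  included, as these eigenvectors are closed under multiplication by \<open>-\<i>\<close>.\<close>

definition real_generalised_eigenspace :: "'e::real_vector set \<Rightarrow> ('e \<Rightarrow> 'e) \<Rightarrow> complex \<Rightarrow> 'e set" where
  "real_generalised_eigenspace E L \<mu> =
     fst ` {w \<in> E \<times> E. \<exists>n. (complexified_minus L \<mu> ^^ n) w = 0}"

definition center_subspace :: "'e::real_vector set \<Rightarrow> ('e \<Rightarrow> 'e) \<Rightarrow> 'e set" where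
  "center_subspace E L =
     span (\<Union>\<mu>\<in>{\<mu>. complex_eigenvalue E L \<mu> \<and> Re \<mu> = 0}. real_generalised_eigenspace E L \<mu>)"

definition hyperbolic_subspace :: "'e::real_vector set \<Rightarrow> ('e \<Rightarrow> 'e) \<Rightarrow> 'e set" where
  "hyperbolic_subspace E L =
     span (\<Union>\<mu>\<in>{\<mu>. complex_eigenvalue E L \<mu> \<and> Re \<mu> \<noteq> 0}. real_generalised_eigenspace E L \<mu>)"

definition center_projection :: "'e::real_vector set \<Rightarrow> ('e \<Rightarrow> 'e) \<Rightarrow> 'e \<Rightarrow> 'e" where
  "center_projection E L x = (THE y. y \<in> center_subspace E L \<and> x - y \<in> hyperbolic_subspace E L)"

definition hyperbolic_projection :: "'e::real_vector set \<Rightarrow> ('e \<Rightarrow> 'e) \<Rightarrow> 'e \<Rightarrow> 'e" where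
  "hyperbolic_projection E L x = x - center_projection E L x"


section \<open>Differentiability on a subspace\<close>

text \<open>For a subspace \<open>E\<close> and \<open>x, v \<in> E\<close>, the value \<open>directional_derivative E f v x\<close> is \<open>Df(x) v\<close>
  for the map \<open>f\<close> restricted to \<open>E\<close>. The derivative within \<open>E\<close> is not unique as a linear map on
  the ambient space, but its values on \<open>E\<close> are.\<close>

definition directional_derivative ::
  "'e::real_normed_vector set \<Rightarrow> ('e \<Rightarrow> 'f::real_normed_vector) \<Rightarrow> 'e \<Rightarrow> 'e \<Rightarrow> 'f" where
  "directional_derivative E f v x = frechet_derivative f (at x within E) v"

primrec C_on :: "nat \<Rightarrow> 'e::real_normed_vector set \<Rightarrow> ('e \<Rightarrow> 'f::real_normed_vector) \<Rightarrow> bool" where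
  "C_on 0 E f \<longleftrightarrow> continuous_on E f"
| "C_on (Suc k) E f \<longleftrightarrow> (\<forall>x\<in>E. f differentiable (at x within E)) \<and>
     (\<forall>v\<in>E. C_on k E (directional_derivative E f v))"

text \<open>The partial derivative \<open>D\<^sup>\<alpha>\<close> corresponds to the list of directions that contains the
  \<open>i\<close>-th basis vector \<open>\<alpha>\<^sub>i\<close> times; its length is \<open>|\<alpha>|\<close>. Arbitrary directions are allowed, so no
  basis of the subspace needs to be chosen.\<close>

primrec iterated_derivative ::
  "'e::real_normed_vector set \<Rightarrow> 'e list \<Rightarrow> ('e \<Rightarrow> 'f::real_normed_vector) \<Rightarrow> 'e \<Rightarrow> 'f" where
  "iterated_derivative E [] f = f"
| "iterated_derivative E (v # vs) f = iterated_derivative E vs (directional_derivative E f v)"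

definition bounded_derivatives_on ::
  "nat \<Rightarrow> 'e::real_normed_vector set \<Rightarrow> ('e \<Rightarrow> 'f::real_normed_vector) \<Rightarrow> bool" where
  "bounded_derivatives_on k E f \<longleftrightarrow>
     (\<forall>vs. set vs \<subseteq> E \<and> length vs \<le> k \<longrightarrow> bounded (iterated_derivative E vs f ` E))"

text \<open>The operator norm of a linear map on \<open>E\<close>; compare \<open>onorm_def\<close>.\<close>

definition onorm_on ::
  "'e::real_normed_vector set \<Rightarrow> ('e \<Rightarrow> 'f::real_normed_vector) \<Rightarrow> real" where
  "onorm_on E f = (SUP v\<in>E. norm (f v) / norm v)"


section \<open>Flows and center manifolds\<close>

definition ode_solution ::
  "'e::real_normed_vector set \<Rightarrow> ('e \<Rightarrow> 'e) \<Rightarrow> 'e \<Rightarrow> (real \<Rightarrow> 'e) \<Rightarrow> bool" where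
  "ode_solution E F x u \<longleftrightarrow> u 0 = x \<and>
     (\<forall>t. u t \<in> E \<and> (u has_vector_derivative F (u t)) (at t))"

text \<open>Only meaningful for complete vector fields. Those considered below are globally Lipschitz.\<close>

definition flow ::
  "'e::real_normed_vector set \<Rightarrow> ('e \<Rightarrow> 'e) \<Rightarrow> real \<Rightarrow> 'e \<Rightarrow> 'e" where
  "flow E F t x = (THE u. ode_solution E F x u) t"

definition center_manifold_hyps ::
  "nat \<Rightarrow> 'e::euclidean_space set \<Rightarrow> ('e \<Rightarrow> 'e) \<Rightarrow> real \<Rightarrow> ('e \<Rightarrow> 'e) \<Rightarrow> bool" where
  "center_manifold_hyps k E L \<epsilon> F \<longleftrightarrow>
     F \<in> E \<rightarrow> E \<and> C_on k E F \<and> F 0 = 0 \<and>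
     (\<forall>v\<in>E. directional_derivative E F v 0 = L v) \<and>
     bounded_derivatives_on k E (\<lambda>x. F x - L x) \<and>
     (SUP x\<in>E. onorm_on E (\<lambda>v. directional_derivative E F v x - L v)) < \<epsilon>"

definition center_graph ::
  "'e::euclidean_space set \<Rightarrow> ('e \<Rightarrow> 'e) \<Rightarrow> ('e \<Rightarrow> 'e) \<Rightarrow> 'e set" where
  "center_graph E L \<phi> = {x + \<phi> x | x. x \<in> center_subspace E L}"

text \<open>The conclusion of the global center manifold theorem for the map \<open>\<phi>\<close>.\<close>

definition is_center_manifold_map ::
  "nat \<Rightarrow> 'e::euclidean_space set \<Rightarrow> ('e \<Rightarrow> 'e) \<Rightarrow> ('e \<Rightarrow> 'e) \<Rightarrow> ('e \<Rightarrow> 'e) \<Rightarrow> bool" where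
  "is_center_manifold_map k E L F \<phi> \<longleftrightarrow>
     \<phi> \<in> center_subspace E L \<rightarrow> hyperbolic_subspace E L \<and>
     C_on k (center_subspace E L) \<phi> \<and> \<phi> 0 = 0 \<and>
     (\<forall>v\<in>center_subspace E L. directional_derivative (center_subspace E L) \<phi> v 0 = 0) \<and>
     (\<forall>t. flow E F t ` center_graph E L \<phi> \<subseteq> center_graph E L \<phi>) \<and>
     center_graph E L \<phi> =
       {x \<in> E. bounded (range (\<lambda>t. hyperbolic_projection E L (flow E F t x)))}"

text \<open>\<open>\<epsilon>\<close> is a constant \<open>\<epsilon>(L, k)\<close> for which the global center manifold theorem holds. The theorem
  says that every linear \<open>L\<close> on \<open>E\<close> and every \<open>k \<ge> 1\<close> admit such an \<open>\<epsilon>\<close>.\<close>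

definition center_manifold_constant ::
  "nat \<Rightarrow> 'e::euclidean_space set \<Rightarrow> ('e \<Rightarrow> 'e) \<Rightarrow> real \<Rightarrow> bool" where
  "center_manifold_constant k E L \<epsilon> \<longleftrightarrow> \<epsilon> > 0 \<and>
     (\<forall>F. center_manifold_hyps k E L \<epsilon> F \<longrightarrow> (\<exists>\<phi>. is_center_manifold_map k E L F \<phi>))"

text \<open>The choice is unique on the center subspace, see \<open>is_center_manifold_map_unique\<close>.\<close>

definition center_manifold_map ::
  "nat \<Rightarrow> 'e::euclidean_space set \<Rightarrow> ('e \<Rightarrow> 'e) \<Rightarrow> ('e \<Rightarrow> 'e) \<Rightarrow> 'e \<Rightarrow> 'e" where
  "center_manifold_map k E L F = (SOME \<phi>. is_center_manifold_map k E L F \<phi>)"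

definition center_manifold ::
  "nat \<Rightarrow> 'e::euclidean_space set \<Rightarrow> ('e \<Rightarrow> 'e) \<Rightarrow> ('e \<Rightarrow> 'e) \<Rightarrow> 'e set" where
  "center_manifold k E L F = center_graph E L (center_manifold_map k E L F)"

definition center_reduction ::
  "nat \<Rightarrow> 'e::euclidean_space set \<Rightarrow> ('e \<Rightarrow> 'e) \<Rightarrow> ('e \<Rightarrow> 'e) \<Rightarrow> 'e \<Rightarrow> 'e" where
  "center_reduction k E L F x = center_projection E L (F (x + center_manifold_map k E L F x))"

lemma is_center_manifold_map_center_manifold_map:
  assumes "center_manifold_constant k E L \<epsilon>" and "center_manifold_hyps k E L \<epsilon> F"
  shows "is_center_manifold_map k E L F (center_manifold_map k E L F)"
proof -
  have "\<exists>\<phi>. is_center_manifold_map k E L F \<phi>"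
    using assms by (simp add: center_manifold_constant_def)
  then show ?thesis
    unfolding center_manifold_map_def by (rule someI_ex)
qed

lemma is_center_manifold_map_unique:
  assumes inter: "center_subspace E L \<inter> hyperbolic_subspace E L = {0}"
    and \<phi>: "is_center_manifold_map k E L F \<phi>" and \<psi>: "is_center_manifold_map k E L F \<psi>"
    and x: "x \<in> center_subspace E L"
  shows "\<phi> x = \<psi> x"
proof -
  have graph: "center_graph E L \<xi> = {x \<in> E. bounded (range (\<lambda>t. hyperbolic_projection E L (flow E F t x)))}"
    and maps: "\<xi> \<in> center_subspace E L \<rightarrow> hyperbolic_subspace E L"
    if "is_center_manifold_map k E L F \<xi>" for \<xi>
    using that unfolding is_center_manifold_map_def by - (elim conjE, assumption)+
  have "center_graph E L \<phi> = center_graph E L \<psi>"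
    by (rule trans[OF graph[OF \<phi>] graph[OF \<psi>, symmetric]])
  moreover have "x + \<phi> x \<in> center_graph E L \<phi>"
    unfolding center_graph_def by (rule CollectI, rule exI, rule conjI[OF refl x])
  ultimately have "x + \<phi> x \<in> center_graph E L \<psi>" by (rule subst)
  then have "\<exists>y. x + \<phi> x = y + \<psi> y \<and> y \<in> center_subspace E L"
    unfolding center_graph_def by (rule CollectD)
  then obtain y where eq: "x + \<phi> x = y + \<psi> y" and y: "y \<in> center_subspace E L"
    by (elim exE conjE)
  have "\<psi> y - \<phi> x \<in> hyperbolic_subspace E L"
    using funcset_mem[OF maps[OF \<psi>] y] funcset_mem[OF maps[OF \<phi>] x]
    unfolding hyperbolic_subspace_def by (rule span_diff)
  moreover have "x - y \<in> center_subspace E L"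
    using x y unfolding center_subspace_def by (rule span_diff)
  moreover have "x - y = \<psi> y - \<phi> x"
    using eq by (simp only: diff_eq_eq add_diff_eq eq_diff_eq add.commute)
  ultimately have "x - y \<in> center_subspace E L \<inter> hyperbolic_subspace E L"
    by (simp only: Int_iff)
  then have "x = y"
    unfolding inter by (simp only: singleton_iff right_minus_eq)
  with eq show ?thesis by (simp only: add_left_cancel)
qed

end

theory Submission
  imports Defs "HOL-Computational_Algebra.Computational_Algebra" "HOL-Computational_Algebra.Field_as_Ring"
begin

text \<open>The center manifold has a description that does not mention the map whose graph it is: it
consists of the points whose orbit has a bounded hyperbolic part. An equivariant linear map
\<open>R\<close> preserves every ingredient of this description. From \<open>R L = L' R\<close> it follows that \<open>R\<close> sends
generalised eigenvectors to generalised eigenvectors for the same eigenvalue (or to \<open>0\<close>), so it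
respects the splittings into center and hyperbolic subspaces and commutes with both projections.
From \<open>R F = F' R\<close> it follows that \<open>R\<close> sends solutions to solutions, so it commutes with the flows.
As \<open>R\<close> is bounded, it sends bounded orbits to bounded orbits, hence \<open>M\<^sup>c\<close> to \<open>M'\<^sup>c\<close>. A point of a graph
over the center subspace is determined by its center component, so \<open>R (\<phi> x) = \<phi>' (R x)\<close>, and the
statement on the reduced vector fields is then a computation.

Two classical facts are needed to make this argument work. The first is that the center and
hyperbolic subspaces are complementary, without which the projections are not defined
(\<open>center_hyperbolic_decomposition\<close>). The proof lets complex polynomials act on the
complexification; Bezout's identity splits every vector into generalised eigenvectors, and the
same identity shows that a vector annihilated by two polynomials without common roots is \<open>0\<close>.

The second is that the flow exists and is unique (\<open>ode_solution_exists\<close>, \<open>ode_solution_unique\<close>), as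
\<^const>\<open>flow\<close> is a definite description. The bounds on the derivatives make \<open>F - L\<close>, and thus \<open>F\<close>,
globally Lipschitz (\<open>center_manifold_hyps_lipschitz\<close>). Existence for all times follows
from a single application of the Banach fixed point theorem in an exponentially weighted space
of curves (\<open>global_solution_exists\<close>), and uniqueness from a Gronwall estimate.\<close>

section \<open>Linear maps on subspaces\<close>

lemma linear_retraction:
  fixes D :: "'e::euclidean_space set"
  assumes "subspace D"
  obtains P where "linear P" and "\<And>x. P x \<in> D" and "\<And>x. x \<in> D \<Longrightarrow> P x = x"
proof -
  have "\<exists>P. range P \<subseteq> D \<and> linear P \<and> (\<forall>x\<in>D. P (id x) = x)"
    by (rule linear_exists_left_inverse_on[OF linear_id assms]) simp
  then show thesis using that by auto
qed

text \<open>The maps in a representation are controlled only on a subspace. Replacing them by total linear maps with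
the same values there gives access to the general theory of linear maps.\<close>

lemma linear_map_on_extension:
  fixes D :: "'e::euclidean_space set" and E :: "'f::euclidean_space set"
  assumes "subspace D" and f: "linear_map_on D E f"
  obtains g where "linear g" and "\<And>x. x \<in> D \<Longrightarrow> g x = f x"
proof -
  obtain P where P: "\<And>x. P x \<in> D" "linear P" "\<And>x. x \<in> D \<Longrightarrow> P x = x"
    using linear_retraction[OF \<open>subspace D\<close>] by metis
  have "linear (\<lambda>x. f (P x))"
  proof (rule linearI)
    show "f (P (x + y)) = f (P x) + f (P y)" for x y
      using f P(1) unfolding linear_map_on_def linear_add[OF P(2)] by blast
    show "f (P (c *\<^sub>R x)) = c *\<^sub>R f (P x)" for c x
      using f P(1) unfolding linear_map_on_def linear_scale[OF P(2)] by blast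
  qed
  then show thesis by (rule that) (simp add: P(3))
qed

lemma linear_map_on_0:
  assumes "subspace D" and "linear_map_on D E f" shows "f 0 = 0"
proof -
  have "f (0 *\<^sub>R 0) = 0 *\<^sub>R f 0"
    using assms subspace_0[OF assms(1)] unfolding linear_map_on_def by blast
  then show ?thesis by simp
qed

section \<open>Complex polynomials acting on the complexification\<close>

text \<open>The pair \<open>(x, y)\<close> stands for \<open>x + \<i> y\<close>, as in \<^const>\<open>complexified_minus\<close>; this is multiplication by a
complex number.\<close>

definition complex_scale :: "complex \<Rightarrow> 'e::real_vector \<times> 'e \<Rightarrow> 'e \<times> 'e" where
  "complex_scale c w = (Re c *\<^sub>R fst w - Im c *\<^sub>R snd w, Re c *\<^sub>R snd w + Im c *\<^sub>R fst w)"

lemma complex_scale_add_right: "complex_scale c (w + z) = complex_scale c w + complex_scale c z"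
  by (simp add: complex_scale_def algebra_simps)

lemma complex_scale_add_left: "complex_scale (c + d) w = complex_scale c w + complex_scale d w"
  by (simp add: complex_scale_def algebra_simps)

lemma complex_scale_mult: "complex_scale (c * d) w = complex_scale c (complex_scale d w)"
  by (simp add: complex_scale_def algebra_simps)

lemma complex_scale_0_left [simp]: "complex_scale 0 w = 0"
  by (simp add: complex_scale_def zero_prod_def)

lemma complex_scale_0_right [simp]: "complex_scale c 0 = 0"
  by (simp add: complex_scale_def zero_prod_def)

lemma complex_scale_1 [simp]: "complex_scale 1 w = w"
  by (simp add: complex_scale_def)

lemma complex_scale_of_real: "complex_scale (of_real r) w = r *\<^sub>R w"
  by (simp add: complex_scale_def scaleR_prod_def)

lemma complex_scale_in_Times:
  "subspace E \<Longrightarrow> w \<in> E \<times> E \<Longrightarrow> complex_scale c w \<in> E \<times> E"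
  by (auto simp: complex_scale_def intro!: subspace_add subspace_diff subspace_scale)

lemma complexified_minus_eq: "complexified_minus L \<mu> w = map_prod L L w - complex_scale \<mu> w"
  by (cases w) (simp add: complexified_minus_def complex_scale_def)

text \<open>The operator \<open>p(L)\<close> on the complexification: \<open>map_prod L L\<close> is the complexification of \<open>L\<close>.\<close>

definition polynomial_action :: "('e::real_vector \<Rightarrow> 'e) \<Rightarrow> complex poly \<Rightarrow> 'e \<times> 'e \<Rightarrow> 'e \<times> 'e" where
  "polynomial_action L p w = (\<Sum>i\<le>degree p. complex_scale (coeff p i) ((map_prod L L ^^ i) w))"

lemma polynomial_action_0 [simp]: "polynomial_action L 0 w = 0"
  by (simp add: polynomial_action_def)

text \<open>Horner's rule. It reduces the algebraic laws of the action to inductions on the polynomial.\<close>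

lemma polynomial_action_pCons:
  "polynomial_action L (pCons a p) w = complex_scale a w + polynomial_action L p (map_prod L L w)"
proof (cases "p = 0")
  case True
  then show ?thesis by (simp add: polynomial_action_def)
next
  case False
  then show ?thesis
    by (simp add: polynomial_action_def sum.atMost_Suc_shift funpow_swap1 del: sum.atMost_Suc)
qed

lemma polynomial_action_const: "polynomial_action L [:a:] w = complex_scale a w"
  by (simp add: polynomial_action_def)

lemma polynomial_action_1 [simp]: "polynomial_action L 1 w = w"
  by (simp add: polynomial_action_def)

lemma polynomial_action_add:
  "polynomial_action L (p + q) w = polynomial_action L p w + polynomial_action L q w"
  by (induction p q arbitrary: w rule: poly_induct2)
    (simp_all add: polynomial_action_pCons complex_scale_add_left)

lemma polynomial_action_smult:
  "polynomial_action L (smult c p) w = complex_scale c (polynomial_action L p w)"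
  by (induction p arbitrary: w)
    (simp_all add: polynomial_action_pCons complex_scale_add_right complex_scale_mult)

context
  fixes L :: "'e::real_vector \<Rightarrow> 'e"
  assumes L: "linear L"
begin

lemma map_prod_add: "map_prod L L (w + z) = map_prod L L w + map_prod L L z"
  by (cases w; cases z) (simp add: linear_add[OF L])

lemma map_prod_complex_scale: "map_prod L L (complex_scale c w) = complex_scale c (map_prod L L w)"
  by (cases w) (simp add: complex_scale_def linear_add[OF L] linear_diff[OF L] linear_scale[OF L])

lemma polynomial_action_add_right:
  "polynomial_action L p (w + z) = polynomial_action L p w + polynomial_action L p z"
  by (induction p arbitrary: w z)
    (simp_all add: polynomial_action_pCons complex_scale_add_right map_prod_add)

lemma polynomial_action_complex_scale:
  "polynomial_action L p (complex_scale c w) = complex_scale c (polynomial_action L p w)"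
  by (induction p arbitrary: w)
    (simp_all add: polynomial_action_pCons complex_scale_add_right map_prod_complex_scale
      flip: complex_scale_mult, simp add: mult.commute)

lemma polynomial_action_0_right [simp]: "polynomial_action L p 0 = 0"
  using polynomial_action_complex_scale[of p 0 0] by simp

lemma polynomial_action_map_prod:
  "polynomial_action L p (map_prod L L w) = map_prod L L (polynomial_action L p w)"
  by (induction p arbitrary: w)
    (simp_all add: polynomial_action_pCons map_prod_add map_prod_complex_scale,
     simp add: zero_prod_def linear_0[OF L])

lemma polynomial_action_mult:
  "polynomial_action L (p * q) w = polynomial_action L p (polynomial_action L q w)"
  by (induction p arbitrary: w)
    (simp_all add: polynomial_action_pCons polynomial_action_add polynomial_action_smult
      polynomial_action_map_prod)

lemma polynomial_action_linear_factor:
  "polynomial_action L [:- \<mu>, 1:] w = complexified_minus L \<mu> w"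
  by (simp add: polynomial_action_pCons complexified_minus_eq)
    (simp add: complex_scale_def)

lemma polynomial_action_linear_factor_power:
  "polynomial_action L ([:- \<mu>, 1:] ^ n) w = (complexified_minus L \<mu> ^^ n) w"
  by (induction n) (simp_all add: polynomial_action_mult polynomial_action_linear_factor del: mult_pCons_left)

lemma polynomial_action_in_Times:
  assumes "subspace E" and "L \<in> E \<rightarrow> E" and "w \<in> E \<times> E"
  shows "polynomial_action L p w \<in> E \<times> E"
  using assms(3)
proof (induction p arbitrary: w)
  case 0
  then show ?case using subspace_0[OF assms(1)] by (simp add: zero_prod_def)
next
  case (pCons a p)
  have "map_prod L L w \<in> E \<times> E" using pCons.prems assms(2) by auto
  then have "polynomial_action L p (map_prod L L w) \<in> E \<times> E" by (rule pCons.IH)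
  with complex_scale_in_Times[OF assms(1) pCons.prems, of a] show ?case
    unfolding polynomial_action_pCons
    by (auto simp: mem_Times_iff intro: subspace_add[OF assms(1)])
qed

end

text \<open>A nonconstant common divisor would have a root by the fundamental theorem of algebra.\<close>

lemma bezout_no_common_root:
  fixes p q :: "complex poly"
  assumes "\<And>z. poly p z = 0 \<Longrightarrow> poly q z \<noteq> 0"
  obtains a b where "a * p + b * q = 1"
proof -
  define d where "d = gcd p q"
  have dp: "d dvd p" and dq: "d dvd q" by (simp_all add: d_def)
  have "poly d z \<noteq> 0" for z
    using assms[of z] dp dq by (auto simp: dvd_def)
  then have "degree d = 0"
    using fundamental_theorem_of_algebra[of d] by (auto simp: constant_degree)
  then have "is_unit d"
    using \<open>\<And>z. poly d z \<noteq> 0\<close> by (metis is_unit_iff_degree poly_0)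
  then have "gcd p q = 1" by (simp add: d_def)
  then show thesis
    using that bezout_coefficients_fst_snd[of p q] by metis
qed

text \<open>By dimension, the iterates \<open>w, L w, L\<^sup>2 w, \<dots>\<close> are linearly dependent. Real coefficients
suffice, as the complexification also has finite real dimension.\<close>

lemma annihilating_polynomial:
  fixes L :: "'e::euclidean_space \<Rightarrow> 'e"
  assumes "linear L"
  obtains p where "p \<noteq> 0" and "polynomial_action L p w = 0"
proof -
  define g where "g i = (map_prod L L ^^ i) w" for i
  define n where "n = DIM('e \<times> 'e)"
  \<comment> \<open>If two iterates coincide, dependence of the set of iterates does not give a relation;
    then the difference of the two is one.\<close>
  obtain c where c: "\<exists>i\<le>n. c i \<noteq> (0::real)" "(\<Sum>i\<le>n. c i *\<^sub>R g i) = 0"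
  proof (cases "inj_on g {..n}")
    case True
    then have "card (g ` {..n}) > n" by (simp add: card_image)
    then have "dependent (g ` {..n})"
      using independent_bound[of "g ` {..n}"] unfolding n_def by linarith
    then obtain u where u: "\<exists>v\<in>g ` {..n}. u v \<noteq> 0" "(\<Sum>v\<in>g ` {..n}. u v *\<^sub>R v) = 0"
      by (auto simp: dependent_finite)
    show thesis
      by (rule that[of "\<lambda>i. u (g i)"]) (use u True in \<open>auto simp: sum.reindex\<close>)
  next
    case False
    then obtain i j where ij: "i \<le> n" "j \<le> n" "i \<noteq> j" "g i = g j" by (auto simp: inj_on_def)
    define c where "c l = (if l = i then 1 else if l = j then -1 else (0::real))" for l
    have "(\<Sum>l\<le>n. c l *\<^sub>R g l) = (\<Sum>l\<in>{i, j}. c l *\<^sub>R g l)"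
      by (rule sum.mono_neutral_right) (use ij in \<open>auto simp: c_def\<close>)
    also have "\<dots> = 0" using ij by (simp add: c_def)
    finally show thesis
      by (intro that[of c]) (use ij in \<open>auto simp: c_def\<close>)
  qed
  define p where "p = (\<Sum>i\<le>n. monom (of_real (c i) :: complex) i)"
  have coeff_p: "coeff p i = (if i \<le> n then of_real (c i) else 0)" for i
    by (simp add: p_def coeff_sum)
  have "degree p \<le> n" by (rule degree_le) (simp add: coeff_p)
  then have "polynomial_action L p w = (\<Sum>i\<le>n. complex_scale (coeff p i) (g i))"
    unfolding polynomial_action_def g_def
    by (intro sum.mono_neutral_left) (auto simp: coeff_eq_0)
  also have "\<dots> = (\<Sum>i\<le>n. c i *\<^sub>R g i)"
    by (rule sum.cong) (simp_all add: coeff_p complex_scale_of_real)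
  finally have "polynomial_action L p w = 0" using c(2) by simp
  moreover have "p \<noteq> 0" using c(1) coeff_p by (metis coeff_0 of_real_eq_0_iff)
  ultimately show thesis by (rule that[rotated])
qed

section \<open>The spectral decomposition\<close>

text \<open>The common form of the center and the hyperbolic subspace, so that both are treated at once.\<close>

definition spectral_subspace :: "'e::real_vector set \<Rightarrow> ('e \<Rightarrow> 'e) \<Rightarrow> complex set \<Rightarrow> 'e set" where
  "spectral_subspace E L S =
     span (\<Union>\<mu>\<in>{\<mu>. complex_eigenvalue E L \<mu> \<and> \<mu> \<in> S}. real_generalised_eigenspace E L \<mu>)"

lemma center_subspace_eq: "center_subspace E L = spectral_subspace E L {\<mu>. Re \<mu> = 0}"
  and hyperbolic_subspace_eq: "hyperbolic_subspace E L = spectral_subspace E L (- {\<mu>. Re \<mu> = 0})"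
  by (simp_all add: center_subspace_def hyperbolic_subspace_def spectral_subspace_def)

lemma subspace_spectral_subspace: "subspace (spectral_subspace E L S)"
  by (simp add: spectral_subspace_def subspace_span)

lemma spectral_subspace_subset:
  assumes "subspace E" shows "spectral_subspace E L S \<subseteq> E"
  unfolding spectral_subspace_def
  by (rule span_minimal) (auto simp: real_generalised_eigenspace_def assms)

lemma complexified_minus_in_Times:
  assumes "subspace E" and "L \<in> E \<rightarrow> E" and "w \<in> E \<times> E"
  shows "complexified_minus L \<mu> w \<in> E \<times> E"
  using assms by (auto simp: complexified_minus_def intro!: subspace_add subspace_diff subspace_scale)

text \<open>If \<open>R\<close> intertwines \<open>L\<close> and \<open>L'\<close>, its complexification intertwines all powers of \<open>L - \<mu>\<close> and
\<open>L' - \<mu>\<close>. With \<open>R\<close> the identity, this compares two maps that agree on \<open>E\<close>.\<close>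

lemma complexified_minus_funpow_intertwine:
  assumes "subspace E" and "linear R" and "L \<in> E \<rightarrow> E"
    and RL: "\<And>x. x \<in> E \<Longrightarrow> R (L x) = L' (R x)" and "w \<in> E \<times> E"
  shows "(complexified_minus L \<mu> ^^ n) w \<in> E \<times> E"
    and "map_prod R R ((complexified_minus L \<mu> ^^ n) w) = (complexified_minus L' \<mu> ^^ n) (map_prod R R w)"
proof -
  have in_E: "(complexified_minus L \<mu> ^^ n) w \<in> E \<times> E" for n
    using assms(5) by (induction n) (simp_all add: complexified_minus_in_Times[OF assms(1,3)])
  then show "(complexified_minus L \<mu> ^^ n) w \<in> E \<times> E" .
  have step: "map_prod R R (complexified_minus L \<mu> z) = complexified_minus L' \<mu> (map_prod R R z)"
    if "z \<in> E \<times> E" for z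
    using that assms(2) RL
    by (auto simp: complexified_minus_def linear_add linear_diff linear_scale)
  show "map_prod R R ((complexified_minus L \<mu> ^^ n) w) = (complexified_minus L' \<mu> ^^ n) (map_prod R R w)"
    by (induction n) (simp_all add: step in_E)
qed

text \<open>The definition of the spectral subspace ranges over eigenvalues only. For other \<open>\<mu>\<close> every
generalised eigenvector vanishes: otherwise its last nonzero image under the powers of
\<open>L - \<mu>\<close> would be an eigenvector. So membership can be shown without knowing that \<open>\<mu>\<close> is an eigenvalue.\<close>

lemma generalised_eigenvector_in_spectral_subspace:
  assumes "subspace E" and "L \<in> E \<rightarrow> E" and "L 0 = 0" and w: "w \<in> E \<times> E"
    and "(complexified_minus L \<mu> ^^ n) w = 0" and "\<mu> \<in> S"
  shows "fst w \<in> spectral_subspace E L S"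
proof (cases "w = 0")
  case True
  then show ?thesis by (simp add: subspace_0[OF subspace_spectral_subspace])
next
  case False
  define m where "m = (LEAST m. (complexified_minus L \<mu> ^^ m) w = 0)"
  have m: "(complexified_minus L \<mu> ^^ m) w = 0"
    unfolding m_def by (rule LeastI, rule assms(5))
  have "m \<noteq> 0"
    using False m by (cases m) auto
  then obtain l where l: "m = Suc l" by (cases m) auto
  have "(complexified_minus L \<mu> ^^ l) w \<noteq> 0"
    using l not_less_Least[of l "\<lambda>m. (complexified_minus L \<mu> ^^ m) w = 0"] by (simp add: m_def)
  moreover have "(complexified_minus L \<mu> ^^ l) w \<in> E \<times> E"
    using w by (induction l) (simp_all add: complexified_minus_in_Times[OF assms(1,2)])
  moreover have "complexified_minus L \<mu> ((complexified_minus L \<mu> ^^ l) w) = 0"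
    using m l by simp
  ultimately have "complex_eigenvalue E L \<mu>"
    unfolding complex_eigenvalue_def by (intro bexI[of _ "(complexified_minus L \<mu> ^^ l) w"] conjI)
  moreover have "fst w \<in> real_generalised_eigenspace E L \<mu>"
    unfolding real_generalised_eigenspace_def using w assms(5) by (intro imageI CollectI conjI exI)
  ultimately show ?thesis
    unfolding spectral_subspace_def using \<open>\<mu> \<in> S\<close> by (intro span_base) blast
qed

text \<open>An intertwining map sends a generalised eigenvector to a generalised eigenvector for the same
number, possibly to \<open>0\<close>; then that number need not be an eigenvalue of \<open>L'\<close>, but \<open>0\<close> lies in the span.\<close>

lemma linear_image_spectral_subspace:
  assumes "subspace E" "subspace E'" and "linear R" and "R \<in> E \<rightarrow> E'"
    and "L \<in> E \<rightarrow> E" "L' \<in> E' \<rightarrow> E'" and "L' 0 = 0"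
    and RL: "\<And>x. x \<in> E \<Longrightarrow> R (L x) = L' (R x)"
  shows "R ` spectral_subspace E L S \<subseteq> spectral_subspace E' L' S"
proof -
  let ?U = "\<Union>\<mu>\<in>{\<mu>. complex_eigenvalue E L \<mu> \<and> \<mu> \<in> S}. real_generalised_eigenspace E L \<mu>"
  have "R x \<in> spectral_subspace E' L' S" if "x \<in> ?U" for x
  proof -
    from that obtain \<mu> w n where w: "\<mu> \<in> S" "w \<in> E \<times> E" "(complexified_minus L \<mu> ^^ n) w = 0"
      and x: "x = fst w"
      by (auto simp: real_generalised_eigenspace_def)
    have "(complexified_minus L' \<mu> ^^ n) (map_prod R R w) = map_prod R R 0"
      using complexified_minus_funpow_intertwine(2)[OF assms(1,3,5) RL w(2), of n \<mu>]
      unfolding w(3) by (rule sym)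
    then have "(complexified_minus L' \<mu> ^^ n) (map_prod R R w) = 0"
      by (simp add: zero_prod_def linear_0[OF \<open>linear R\<close>])
    moreover have "map_prod R R w \<in> E' \<times> E'" using w(2) assms(4) by auto
    ultimately have "fst (map_prod R R w) \<in> spectral_subspace E' L' S"
      by (intro generalised_eigenvector_in_spectral_subspace[OF assms(2,6,7) _ _ w(1)])
    then show ?thesis by (simp add: x)
  qed
  then have "span (R ` ?U) \<subseteq> spectral_subspace E' L' S"
    by (intro span_minimal subspace_spectral_subspace) blast
  then show ?thesis
    by (simp add: spectral_subspace_def linear_span_image[OF \<open>linear R\<close>])
qed

text \<open>Let \<open>p(L) w = 0\<close> and \<open>p = (X - \<mu>)\<^sup>m q\<close> with \<open>q(\<mu>) \<noteq> 0\<close>. Bezout's identity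
\<open>a (X - \<mu>)\<^sup>m + b q = 1\<close> splits \<open>w\<close> into a vector annihilated by \<open>q\<close>, which has smaller degree, and
a vector annihilated by \<open>(L - \<mu>)\<^sup>m\<close>, which is a generalised eigenvector.\<close>

lemma generalised_eigenvectors_span:
  fixes L :: "'e::euclidean_space \<Rightarrow> 'e"
  assumes L: "linear L" and E: "subspace E" "L \<in> E \<rightarrow> E"
    and p: "p \<noteq> 0" "polynomial_action L p w = 0" and w: "w \<in> E \<times> E"
  shows "fst w \<in> spectral_subspace E L UNIV"
  using p w
proof (induction "degree p" arbitrary: p w rule: less_induct)
  case less
  show ?case
  proof (cases "degree p = 0")
    case True
    then obtain c where c: "p = [:c:]" by (rule degree_eq_zeroE)
    with less.prems have "c \<noteq> 0" "complex_scale c w = 0"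
      by (simp_all add: polynomial_action_const)
    then have "w = 0"
      by (metis complex_scale_0_right complex_scale_1 complex_scale_mult left_inverse)
    then show ?thesis by (simp add: subspace_0[OF subspace_spectral_subspace])
  next
    case False
    then obtain \<mu> where \<mu>: "poly p \<mu> = 0"
      using fundamental_theorem_of_algebra by (auto simp: constant_degree)
    define m where "m = order \<mu> p"
    obtain q where q: "p = [:- \<mu>, 1:] ^ m * q" "\<not> [:- \<mu>, 1:] dvd q"
      using order_decomp[OF less.prems(1)] m_def by blast
    have "m \<noteq> 0" using \<mu> less.prems(1) by (simp add: m_def order_root)
    have "q \<noteq> 0" using less.prems(1) q(1) by auto
    have deg: "degree q < degree p"
      using \<open>m \<noteq> 0\<close> \<open>q \<noteq> 0\<close> unfolding q(1) by (simp add: degree_mult_eq degree_power_eq)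
    have "poly ([:- \<mu>, 1:] ^ m) z = 0 \<Longrightarrow> poly q z \<noteq> 0" for z
      using q(2) by (auto simp: poly_eq_0_iff_dvd[symmetric] poly_power)
    then obtain a b where ab: "a * [:- \<mu>, 1:] ^ m + b * q = 1"
      by (rule bezout_no_common_root)
    define w1 where "w1 = polynomial_action L (a * [:- \<mu>, 1:] ^ m) w"
    define w2 where "w2 = polynomial_action L (b * q) w"
    have "w = w1 + w2"
      unfolding w1_def w2_def by (simp only: ab polynomial_action_1 flip: polynomial_action_add)
    have in_E: "w1 \<in> E \<times> E" "w2 \<in> E \<times> E"
      unfolding w1_def w2_def by (rule polynomial_action_in_Times[OF L E less.prems(3)])+
    have "polynomial_action L q w1 = polynomial_action L (a * p) w"
      unfolding w1_def q(1) by (simp only: ac_simps flip: polynomial_action_mult[OF L])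
    also have "\<dots> = 0" by (simp add: polynomial_action_mult[OF L] less.prems(2) polynomial_action_0_right[OF L])
    finally have 1: "fst w1 \<in> spectral_subspace E L UNIV"
      by (intro less.hyps[OF deg \<open>q \<noteq> 0\<close> _ in_E(1)])
    have "(complexified_minus L \<mu> ^^ m) w2 = polynomial_action L (b * p) w"
      unfolding w2_def q(1) polynomial_action_linear_factor_power[OF L, symmetric]
      by (simp only: ac_simps flip: polynomial_action_mult[OF L])
    also have "\<dots> = 0" by (simp add: polynomial_action_mult[OF L] less.prems(2) polynomial_action_0_right[OF L])
    finally have "fst w2 \<in> spectral_subspace E L UNIV"
      by (intro generalised_eigenvector_in_spectral_subspace[OF E linear_0[OF L] in_E(2)]) auto
    with 1 show ?thesis
      unfolding \<open>w = w1 + w2\<close> fst_add by (rule subspace_add[OF subspace_spectral_subspace])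
  qed
qed

text \<open>The vectors annihilated by some polynomial with all roots in \<open>S\<close> form a subspace, because such
polynomials are closed under products. It contains the generalised eigenvectors for \<open>\<mu> \<in> S\<close>,
and by symmetry of \<open>S\<close> also their complex conjugates, hence their real parts.\<close>

lemma spectral_subspace_annihilated:
  fixes L :: "'e::euclidean_space \<Rightarrow> 'e"
  assumes L: "linear L" and S: "cnj ` S \<subseteq> S" and x: "x \<in> spectral_subspace E L S"
  shows "\<exists>p. p \<noteq> 0 \<and> (\<forall>z. poly p z = 0 \<longrightarrow> z \<in> S) \<and> polynomial_action L p (x, 0) = 0"
proof -
  define ann where "ann w \<longleftrightarrow> (\<exists>p. p \<noteq> 0 \<and> (\<forall>z. poly p z = 0 \<longrightarrow> z \<in> S) \<and> polynomial_action L p w = 0)" for w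
  have ann_0: "ann 0"
    unfolding ann_def by (rule exI[of _ 1]) simp
  have ann_add: "ann (w + z)" if "ann w" "ann z" for w z
  proof -
    from that obtain p q where
      "p \<noteq> 0" "\<forall>z. poly p z = 0 \<longrightarrow> z \<in> S" and p: "polynomial_action L p w = 0" and
      "q \<noteq> 0" "\<forall>z. poly q z = 0 \<longrightarrow> z \<in> S" and q: "polynomial_action L q z = 0"
      unfolding ann_def by blast
    moreover have "polynomial_action L (p * q) z = 0"
      by (simp add: polynomial_action_mult[OF L] q polynomial_action_0_right[OF L])
    moreover have "polynomial_action L (p * q) w = 0"
      unfolding mult.commute[of p q]
      by (simp add: polynomial_action_mult[OF L] p polynomial_action_0_right[OF L])
    ultimately show ?thesis
      unfolding ann_def by (intro exI[of _ "p * q"]) (auto simp: polynomial_action_add_right[OF L])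
  qed
  have ann_scale: "ann (complex_scale c w)" if "ann w" for c w
    using that unfolding ann_def by (auto simp: polynomial_action_complex_scale[OF L])
  have "subspace {x. ann (x, 0)}"
  proof (rule subspaceI)
    show "0 \<in> {x. ann (x, 0)}" using ann_0 by (simp add: zero_prod_def)
    show "x + y \<in> {x. ann (x, 0)}" if "x \<in> {x. ann (x, 0)}" "y \<in> {x. ann (x, 0)}" for x y
      using that ann_add[of "(x, 0)" "(y, 0)"] by simp
    show "c *\<^sub>R x \<in> {x. ann (x, 0)}" if "x \<in> {x. ann (x, 0)}" for c x
      using that ann_scale[of "(x, 0)" "of_real c"] by (simp add: complex_scale_of_real)
  qed
  moreover have "ann (fst w, 0)" if "\<mu> \<in> S" and w: "(complexified_minus L \<mu> ^^ n) w = 0" for \<mu> w n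
  proof -
    have root: "ann w" if "\<mu> \<in> S" "(complexified_minus L \<mu> ^^ n) w = 0" for \<mu> w
      unfolding ann_def
      by (rule exI[of _ "[:- \<mu>, 1:] ^ n"])
        (use that in \<open>auto simp: polynomial_action_linear_factor_power[OF L] poly_power\<close>)
    let ?conj = "\<lambda>w::'e \<times> 'e. (fst w, - snd w)"
    have "(complexified_minus L (cnj \<mu>) ^^ n) (?conj w) = ?conj ((complexified_minus L \<mu> ^^ n) w)" for w
      by (induction n) (simp_all add: complexified_minus_def linear_neg[OF L])
    then have "ann (?conj w)"
      using w S \<open>\<mu> \<in> S\<close> by (intro root[of "cnj \<mu>"]) (auto simp: zero_prod_def)
    with root[OF that] have "ann (complex_scale (of_real (1/2)) (w + ?conj w))"
      by (intro ann_scale ann_add)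
    also have "complex_scale (of_real (1/2)) (w + ?conj w) = (fst w, 0)"
      unfolding complex_scale_of_real by (cases w) (simp flip: scaleR_left_distrib add: scaleR_2[symmetric])
    finally show ?thesis .
  qed
  ultimately have "spectral_subspace E L S \<subseteq> {x. ann (x, 0)}"
    unfolding spectral_subspace_def
    by (intro span_minimal) (auto simp: real_generalised_eigenspace_def)
  with x show ?thesis by (auto simp: ann_def)
qed

text \<open>The annihilating polynomials of a common vector have no common root, so by Bezout's identity
the vector is annihilated by \<open>1\<close>.\<close>

lemma spectral_subspace_disjoint:
  fixes L :: "'e::euclidean_space \<Rightarrow> 'e"
  assumes L: "linear L" and "cnj ` S \<subseteq> S" "cnj ` T \<subseteq> T" and "S \<inter> T = {}"
    and "x \<in> spectral_subspace E L S" "x \<in> spectral_subspace E L T"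
  shows "x = 0"
proof -
  obtain p where p: "\<forall>z. poly p z = 0 \<longrightarrow> z \<in> S" "polynomial_action L p (x, 0) = 0"
    using spectral_subspace_annihilated[OF L assms(2,5)] by blast
  obtain q where q: "\<forall>z. poly q z = 0 \<longrightarrow> z \<in> T" "polynomial_action L q (x, 0) = 0"
    using spectral_subspace_annihilated[OF L assms(3,6)] by blast
  obtain a b where "a * p + b * q = 1"
    using p(1) q(1) \<open>S \<inter> T = {}\<close> bezout_no_common_root[of p q] by blast
  then have "(x, 0) = polynomial_action L (a * p + b * q) (x, 0)" by simp
  also have "\<dots> = 0"
    by (simp add: polynomial_action_add polynomial_action_mult[OF L] p(2) q(2) polynomial_action_0_right[OF L])
  finally show ?thesis by (simp add: zero_prod_def)
qed

lemma spectral_subspace_cong: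
  assumes "subspace E" and "\<And>x. x \<in> E \<Longrightarrow> L x = L' x" and "L \<in> E \<rightarrow> E"
  shows "spectral_subspace E L S = spectral_subspace E L' S"
proof -
  have eq: "complexified_minus L \<mu> w = complexified_minus L' \<mu> w" if "w \<in> E \<times> E" for \<mu> w
    using that assms(2) by (auto simp: complexified_minus_def)
  have "complex_eigenvalue E L = complex_eigenvalue E L'"
    unfolding complex_eigenvalue_def by (intro ext bex_cong refl) (simp add: eq)
  moreover have "(complexified_minus L \<mu> ^^ n) w = (complexified_minus L' \<mu> ^^ n) w"
    if "w \<in> E \<times> E" for \<mu> w n
    using complexified_minus_funpow_intertwine(2)[OF assms(1) linear_ident assms(3,2) that]
    by (simp add: map_prod_def case_prod_unfold)
  then have "real_generalised_eigenspace E L = real_generalised_eigenspace E L'"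
    unfolding real_generalised_eigenspace_def
    by (intro ext arg_cong[of _ _ "(`) fst"] Collect_cong conj_cong refl) simp
  ultimately show ?thesis by (simp add: spectral_subspace_def)
qed

text \<open>This is what makes the definite description in \<^const>\<open>center_projection\<close> meaningful.\<close>

lemma center_hyperbolic_decomposition:
  fixes E :: "'e::euclidean_space set"
  assumes E: "subspace E" and L: "linear_map_on E E L" and x: "x \<in> E"
  shows "\<exists>!y. y \<in> center_subspace E L \<and> x - y \<in> hyperbolic_subspace E L"
proof -
  obtain M where M: "linear M" and agree: "\<And>x. x \<in> E \<Longrightarrow> M x = L x"
    using linear_map_on_extension[OF E L] by blast
  have LE: "L \<in> E \<rightarrow> E" using L by (simp add: linear_map_on_def)
  then have ME: "M \<in> E \<rightarrow> E" using agree by auto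
  let ?S = "{\<mu>. Re \<mu> = 0}"
  have cong: "spectral_subspace E L S = spectral_subspace E M S" for S
    by (rule spectral_subspace_cong[OF E _ LE]) (simp add: agree)
  obtain p where "p \<noteq> 0" "polynomial_action M p (x, 0) = 0"
    using annihilating_polynomial[OF M] by blast
  then have "x \<in> spectral_subspace E M UNIV"
    using generalised_eigenvectors_span[OF M E ME, of p "(x, 0)"] x subspace_0[OF E] by simp
  also have "spectral_subspace E M UNIV = {y + z |y z. y \<in> spectral_subspace E M ?S \<and> z \<in> spectral_subspace E M (- ?S)}"
    unfolding spectral_subspace_def
    by (subst span_Un[symmetric]) (rule arg_cong[of _ _ span], blast)
  finally obtain y z where yz: "x = y + z" "y \<in> center_subspace E L" "z \<in> hyperbolic_subspace E L"
    by (auto simp: center_subspace_eq hyperbolic_subspace_eq cong)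
  show ?thesis
  proof (rule ex1I[of _ y])
    show "y \<in> center_subspace E L \<and> x - y \<in> hyperbolic_subspace E L" using yz by simp
    fix y' assume y': "y' \<in> center_subspace E L \<and> x - y' \<in> hyperbolic_subspace E L"
    then have "y' - y \<in> center_subspace E L"
      using yz(2) by (simp add: center_subspace_eq subspace_diff[OF subspace_spectral_subspace])
    moreover have "x - y \<in> hyperbolic_subspace E L" using yz by simp
    then have "(x - y) - (x - y') \<in> hyperbolic_subspace E L"
      using y' unfolding hyperbolic_subspace_eq
      by (blast intro: subspace_diff[OF subspace_spectral_subspace])
    then have "y' - y \<in> hyperbolic_subspace E L" by simp
    ultimately have "y' - y = 0"
      unfolding center_subspace_eq hyperbolic_subspace_eq cong
      by (intro spectral_subspace_disjoint[OF M, of ?S "- ?S"]) auto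
    then show "y' = y" by simp
  qed
qed

section \<open>Global flows of Lipschitz vector fields\<close>

text \<open>The fundamental theorem of calculus concerns compact intervals; here one antiderivative is needed on the
whole line, for positive and negative times together.\<close>

lemma antiderivative_on_line:
  fixes f :: "real \<Rightarrow> 'e::banach"
  assumes f: "continuous_on UNIV f"
  obtains g where "g 0 = 0" and "\<And>t. (g has_vector_derivative f t) (at t)"
proof -
  define g where "g t = (if t \<ge> 0 then integral {0..t} f else - integral {t..0} f)" for t
  have cont: "continuous_on A f" for A
    by (rule continuous_on_subset[OF f]) simp
  have "(g has_vector_derivative f t) (at t)" for t
  proof -
    define N where "N = \<bar>t\<bar> + 1"
    have N: "- N < t" "t < N" "0 < N" by (auto simp: N_def)
    have g_eq: "g s = integral {-N..s} f - integral {-N..0} f" if "s \<in> {-N<..<N}" for s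
    proof (cases "s \<ge> 0")
      case True
      have "integral {-N..0} f + integral {0..s} f = integral {-N..s} f"
        using True N by (intro Henstock_Kurzweil_Integration.integral_combine integrable_continuous_real cont) auto
      then show ?thesis using True by (simp add: g_def algebra_simps)
    next
      case False
      have "integral {-N..s} f + integral {s..0} f = integral {-N..0} f"
        using False that by (intro Henstock_Kurzweil_Integration.integral_combine integrable_continuous_real cont) auto
      then show ?thesis using False by (simp add: g_def algebra_simps)
    qed
    have "((\<lambda>s. integral {-N..s} f) has_vector_derivative f t) (at t within {-N..N})"
      using N by (intro integral_has_vector_derivative cont) auto
    then have "((\<lambda>s. integral {-N..s} f) has_vector_derivative f t) (at t)"
      using N by (simp add: at_within_Icc_at)
    then have "((\<lambda>s. integral {-N..s} f - integral {-N..0} f) has_vector_derivative f t - 0) (at t)"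
      by (intro has_vector_derivative_diff has_vector_derivative_const)
    then have "((\<lambda>s. integral {-N..s} f - integral {-N..0} f) has_vector_derivative f t) (at t)"
      by simp
    then show ?thesis
      by (rule has_vector_derivative_transform_within_open[of _ _ _ "{-N<..<N}"]) (use N g_eq in auto)
  qed
  moreover have "g 0 = 0" by (simp add: g_def)
  ultimately show thesis using that by blast
qed

text \<open>The mean value inequality, with \<open>C / c * exp (c * s)\<close> as the comparison function.\<close>

lemma exponential_growth_bound_nonneg:
  fixes g :: "real \<Rightarrow> 'e::real_normed_vector"
  assumes g: "\<And>t. (g has_vector_derivative g' t) (at t)" "g 0 = 0"
    and bound: "\<And>s. s \<ge> 0 \<Longrightarrow> norm (g' s) \<le> C * exp (c * s)" and "c > 0" "C \<ge> 0" and "t \<ge> 0"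
  shows "norm (g t) \<le> C / c * exp (c * t)"
proof (cases "t = 0")
  case True
  then show ?thesis using assms by simp
next
  case False
  then have "t > 0" using \<open>t \<ge> 0\<close> by simp
  then have "norm (g t - g 0) \<le> C / c * exp (c * t) - C / c * exp (c * 0)"
  proof (rule differentiable_bound_general)
    show "continuous_on {0..t} g"
      using g(1) by (meson continuous_at_imp_continuous_on has_vector_derivative_continuous)
    show "continuous_on {0..t} (\<lambda>s. C / c * exp (c * s))" by (intro continuous_intros)
    show "(g has_vector_derivative g' s) (at s)" for s by (rule g(1))
    show "((\<lambda>s. C / c * exp (c * s)) has_vector_derivative C * exp (c * s)) (at s)" for s
      unfolding has_real_derivative_iff_has_vector_derivative[symmetric]
      using \<open>c > 0\<close> by (auto intro!: derivative_eq_intros)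
    show "norm (g' s) \<le> C * exp (c * s)" if "0 < s" for s using bound that by simp
  qed
  also have "\<dots> \<le> C / c * exp (c * t)" using assms by simp
  finally show ?thesis using g(2) by simp
qed

text \<open>Reversal of time, which transfers estimates from positive to negative times.\<close>

lemma has_vector_derivative_reflect:
  assumes "\<And>t. (g has_vector_derivative g' t) (at t)"
  shows "((\<lambda>t. g (- t)) has_vector_derivative - g' (- t)) (at t)"
proof -
  have "((g \<circ> uminus) has_vector_derivative (- 1) *\<^sub>R g' (- t)) (at t)"
    by (rule vector_diff_chain_at) (auto intro!: derivative_eq_intros assms)
  then show ?thesis by (simp add: o_def)
qed

lemma exponential_growth_bound:
  fixes g :: "real \<Rightarrow> 'e::real_normed_vector"
  assumes g: "\<And>t. (g has_vector_derivative g' t) (at t)" "g 0 = 0"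
    and bound: "\<And>s. norm (g' s) \<le> C * exp (c * \<bar>s\<bar>)" and "c > 0" "C \<ge> 0"
  shows "norm (g t) \<le> C / c * exp (c * \<bar>t\<bar>)"
proof (cases "t \<ge> 0")
  case True
  have "norm (g' s) \<le> C * exp (c * s)" if "s \<ge> 0" for s using bound[of s] that by simp
  from exponential_growth_bound_nonneg[OF g this \<open>c > 0\<close> \<open>C \<ge> 0\<close> True] True
  show ?thesis by simp
next
  case False
  have "norm (- g' (- s)) \<le> C * exp (c * s)" if "s \<ge> 0" for s using bound[of "- s"] that by simp
  from exponential_growth_bound_nonneg[OF has_vector_derivative_reflect[OF g(1)] _ this \<open>c > 0\<close> \<open>C \<ge> 0\<close>, of "- t"]
    False g(2)
  show ?thesis by simp
qed

text \<open>Curves are written as \<open>exp (c \<bar>s\<bar>) h s\<close> with \<open>h\<close> bounded and continuous. In the sup norm of \<open>h\<close>,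
the Picard operator has Lipschitz constant \<open>K / c\<close>: integration of \<open>exp (c \<bar>s\<bar>)\<close> gains a factor
\<open>1 / c\<close>. So for \<open>c > K\<close> it is a contraction on the whole line at once, and no local solutions
have to be continued.\<close>

lemma global_solution_exists:
  fixes G :: "'e::banach \<Rightarrow> 'e"
  assumes lip: "\<And>x y. norm (G x - G y) \<le> K * norm (x - y)" and "K \<ge> 0"
  obtains u where "u 0 = x" and "\<And>t. (u has_vector_derivative G (u t)) (at t)"
proof -
  define c where "c = K + 1"
  have c: "c > 0" "K / c < 1" "K / c \<ge> 0" using \<open>K \<ge> 0\<close> by (simp_all add: c_def)
  have "K-lipschitz_on UNIV G"
    using lip \<open>K \<ge> 0\<close> by (simp add: lipschitz_on_def dist_norm)
  then have cont_G: "continuous_on UNIV G" by (rule lipschitz_on_continuous_on)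
  define curve where "curve h s = exp (c * \<bar>s\<bar>) *\<^sub>R apply_bcontfun h s" for h :: "real \<Rightarrow>\<^sub>C 'e" and s
  have "continuous_on UNIV (curve h)" for h
    unfolding curve_def by (intro continuous_intros continuous_on_apply_bcontfun)
  then have cont: "continuous_on UNIV (\<lambda>s. G (curve h s))" for h
    by (rule continuous_on_compose2[OF cont_G]) simp
  have "\<exists>g. g 0 = 0 \<and> (\<forall>t. (g has_vector_derivative G (curve h t)) (at t))" for h
    using antiderivative_on_line[OF cont] by metis
  then obtain I where I0: "\<And>h. I h 0 = 0"
    and I: "\<And>h t. (I h has_vector_derivative G (curve h t)) (at t)"
    by metis
  \<comment> \<open>The Picard operator, divided by the weight.\<close>
  define T where "T h t = exp (- (c * \<bar>t\<bar>)) *\<^sub>R (x + I h t)" for h t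
  have T: "T h \<in> bcontfun" for h
  proof (rule bcontfun_normI)
    have "continuous_on UNIV (I h)"
      using I by (meson continuous_at_imp_continuous_on has_vector_derivative_continuous)
    then show "continuous_on UNIV (T h)"
      unfolding T_def by (intro continuous_intros)
    define C where "C = norm (G 0) + K * norm h"
    have "C \<ge> 0" using \<open>K \<ge> 0\<close> by (simp add: C_def)
    have "norm (G (curve h s)) \<le> C * exp (c * \<bar>s\<bar>)" for s
    proof -
      have "norm (G (curve h s)) \<le> norm (G 0) + norm (G (curve h s) - G 0)" by (rule norm_triangle_sub)
      also have "\<dots> \<le> norm (G 0) + K * norm (curve h s)" using lip[of "curve h s" 0] by simp
      also have "norm (curve h s) \<le> exp (c * \<bar>s\<bar>) * norm h"
        unfolding curve_def by (simp add: norm_bounded)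
      also have "norm (G 0) + K * (exp (c * \<bar>s\<bar>) * norm h) \<le> C * exp (c * \<bar>s\<bar>)"
        using c(1) mult_left_mono[of 1 "exp (c * \<bar>s\<bar>)" "norm (G 0)"]
        by (simp add: C_def algebra_simps)
      finally show ?thesis using \<open>K \<ge> 0\<close> by (simp add: mult_left_mono)
    qed
    from exponential_growth_bound[OF I I0 this c(1) \<open>C \<ge> 0\<close>]
    have I_bound: "norm (I h t) \<le> C / c * exp (c * \<bar>t\<bar>)" for t .
    show "norm (T h t) \<le> norm x + C / c" for t
    proof -
      have "norm (T h t) \<le> exp (- (c * \<bar>t\<bar>)) * (norm x + C / c * exp (c * \<bar>t\<bar>))"
        unfolding T_def using norm_triangle_ineq[of x "I h t"] I_bound[of t] by simp
      also have "\<dots> = exp (- (c * \<bar>t\<bar>)) * norm x + C / c" by (simp add: algebra_simps exp_minus)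
      also have "\<dots> \<le> norm x + C / c"
        using c(1) mult_right_mono[of "exp (- (c * \<bar>t\<bar>))" 1 "norm x"] by simp
      finally show ?thesis .
    qed
  qed
  have "\<exists>!h. Bcontfun (T h) = h"
  proof (rule banach_fix_type[of "K / c"])
    show "\<forall>h k. dist (Bcontfun (T h)) (Bcontfun (T k)) \<le> K / c * dist h k"
    proof (intro allI dist_bound)
      fix h k t
      have "norm (G (curve h s) - G (curve k s)) \<le> (K * dist h k) * exp (c * \<bar>s\<bar>)" for s
      proof -
        have "norm (curve h s - curve k s) = exp (c * \<bar>s\<bar>) * dist (apply_bcontfun h s) (apply_bcontfun k s)"
          by (simp add: curve_def dist_norm flip: scaleR_diff_right)
        also have "\<dots> \<le> exp (c * \<bar>s\<bar>) * dist h k" by (simp add: dist_bounded)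
        finally have "K * norm (curve h s - curve k s) \<le> K * (exp (c * \<bar>s\<bar>) * dist h k)"
          using \<open>K \<ge> 0\<close> by (rule mult_left_mono)
        with lip[of "curve h s" "curve k s"] show ?thesis by (simp add: mult_ac)
      qed
      then have "norm (I h t - I k t) \<le> K * dist h k / c * exp (c * \<bar>t\<bar>)"
        using c(1) \<open>K \<ge> 0\<close> I0
        by (intro exponential_growth_bound[OF has_vector_derivative_diff[OF I I]]) auto
      then have "exp (- (c * \<bar>t\<bar>)) * norm (I h t - I k t)
          \<le> exp (- (c * \<bar>t\<bar>)) * (K * dist h k / c * exp (c * \<bar>t\<bar>))"
        by (rule mult_left_mono) simp
      also have "\<dots> = K / c * dist h k" by (simp add: exp_minus)
      also have "exp (- (c * \<bar>t\<bar>)) * norm (I h t - I k t) = norm (T h t - T k t)"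
        by (simp add: T_def flip: scaleR_diff_right)
      finally show "dist (apply_bcontfun (Bcontfun (T h)) t) (apply_bcontfun (Bcontfun (T k)) t) \<le> K / c * dist h k"
        by (simp add: Bcontfun_inverse[OF T] dist_norm)
    qed
  qed (use c in auto)
  then obtain h where h: "Bcontfun (T h) = h" by blast
  have "apply_bcontfun h = T h" using Bcontfun_inverse[OF T, of h] h by simp
  then have u: "curve h = (\<lambda>t. x + I h t)"
    by (simp add: fun_eq_iff curve_def T_def exp_minus)
  show thesis
  proof
    show "curve h 0 = x" by (simp add: u I0)
    have "((\<lambda>t. x + I h t) has_vector_derivative 0 + G (curve h t)) (at t)" for t
      by (intro has_vector_derivative_add has_vector_derivative_const I)
    then show "(curve h has_vector_derivative G (curve h t)) (at t)" for t by (simp flip: u)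
  qed
qed

text \<open>By the Cauchy-Schwarz inequality, \<open>exp (- 2 K t) \<bar>d t\<bar>\<^sup>2\<close> is nonincreasing.\<close>

lemma gronwall_zero_nonneg:
  fixes d :: "real \<Rightarrow> 'e::real_inner"
  assumes d: "\<And>t. (d has_vector_derivative d' t) (at t)" "d 0 = 0"
    and bound: "\<And>t. norm (d' t) \<le> K * norm (d t)" and "t \<ge> 0"
  shows "d t = 0"
proof -
  define w where "w s = exp (- (2 * K * s)) * (d s \<bullet> d s)" for s
  have "\<exists>y. (w has_real_derivative y) (at s) \<and> y \<le> 0" for s
  proof (intro exI conjI)
    have "((\<lambda>s. d s \<bullet> d s) has_real_derivative d s \<bullet> d' s + d' s \<bullet> d s) (at s)"
      using bounded_bilinear.has_vector_derivative[OF bounded_bilinear_inner d(1) d(1)]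
      by (simp add: has_real_derivative_iff_has_vector_derivative)
    moreover have "((\<lambda>s. exp (- (2 * K * s))) has_real_derivative exp (- (2 * K * s)) * (- (2 * K))) (at s)"
      by (auto intro!: derivative_eq_intros)
    ultimately show "(w has_real_derivative exp (- (2 * K * s)) * (- (2 * K)) * (d s \<bullet> d s)
        + (d s \<bullet> d' s + d' s \<bullet> d s) * exp (- (2 * K * s))) (at s)"
      unfolding w_def by (intro DERIV_mult)
    have "d s \<bullet> d' s \<le> norm (d s) * norm (d' s)" by (rule norm_cauchy_schwarz)
    also have "\<dots> \<le> norm (d s) * (K * norm (d s))" by (intro mult_left_mono bound) simp
    also have "\<dots> = K * (d s \<bullet> d s)" by (simp add: dot_square_norm power2_eq_square)
    finally have "exp (- (2 * K * s)) * (2 * (d s \<bullet> d' s - K * (d s \<bullet> d s))) \<le> 0"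
      by (intro mult_nonneg_nonpos) auto
    then show "exp (- (2 * K * s)) * (- (2 * K)) * (d s \<bullet> d s)
        + (d s \<bullet> d' s + d' s \<bullet> d s) * exp (- (2 * K * s)) \<le> 0"
      by (simp add: algebra_simps inner_commute)
  qed
  then have "w t \<le> w 0"
    by (intro DERIV_nonpos_imp_nonincreasing[OF \<open>t \<ge> 0\<close>])
  then have "d t \<bullet> d t \<le> 0" using d(2) by (simp add: w_def mult_le_0_iff)
  with inner_ge_zero[of "d t"] have "d t \<bullet> d t = 0" by linarith
  then show ?thesis by simp
qed

lemma gronwall_zero:
  fixes d :: "real \<Rightarrow> 'e::real_inner"
  assumes d: "\<And>t. (d has_vector_derivative d' t) (at t)" "d 0 = 0"
    and bound: "\<And>t. norm (d' t) \<le> K * norm (d t)"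
  shows "d t = 0"
proof (cases "t \<ge> 0")
  case True
  then show ?thesis by (rule gronwall_zero_nonneg[OF assms])
next
  case False
  have "d (- (- t)) = 0"
    by (rule gronwall_zero_nonneg[OF has_vector_derivative_reflect[OF d(1)]])
      (use False d(2) bound in auto)
  then show ?thesis by simp
qed

text \<open>The difference \<open>d\<close> of two solutions satisfies \<open>\<bar>d'\<bar> \<le> K \<bar>d\<bar>\<close> and vanishes at time \<open>0\<close>.\<close>

lemma ode_solution_unique:
  fixes E :: "'e::euclidean_space set"
  assumes lip: "\<And>x y. x \<in> E \<Longrightarrow> y \<in> E \<Longrightarrow> norm (F x - F y) \<le> K * norm (x - y)"
    and u: "ode_solution E F x u" and v: "ode_solution E F x v"
  shows "u = v"
proof
  fix t
  have "u t - v t = 0"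
  proof (rule gronwall_zero)
    show "((\<lambda>t. u t - v t) has_vector_derivative F (u t) - F (v t)) (at t)" for t
      using u v by (intro has_vector_derivative_diff) (simp_all add: ode_solution_def)
    show "norm (F (u t) - F (v t)) \<le> K * norm (u t - v t)" for t
      using u v by (intro lip) (simp_all add: ode_solution_def)
    show "u 0 - v 0 = 0" using u v by (simp add: ode_solution_def)
  qed
  then show "u t = v t" by simp
qed

text \<open>A linear retraction \<open>P\<close> onto \<open>E\<close> turns \<open>F\<close> into the Lipschitz vector field \<open>F \<circ> P\<close> on the ambient
space. A solution that starts in \<open>E\<close> stays there, as \<open>P u - u\<close> has derivative \<open>0\<close>.\<close>

lemma ode_solution_exists:
  fixes E :: "'e::euclidean_space set"
  assumes E: "subspace E" and F: "F \<in> E \<rightarrow> E" and x: "x \<in> E"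
    and lip: "\<And>x y. x \<in> E \<Longrightarrow> y \<in> E \<Longrightarrow> norm (F x - F y) \<le> K * norm (x - y)"
  shows "\<exists>u. ode_solution E F x u"
proof -
  obtain P where P: "linear P" and P_in: "\<And>x. P x \<in> E" and P_id: "\<And>x. x \<in> E \<Longrightarrow> P x = x"
    using linear_retraction[OF E] by metis
  have bl: "bounded_linear P" using P by (simp add: linear_conv_bounded_linear)
  obtain B where B: "B > 0" "\<And>y. norm (P y) \<le> norm y * B"
    using bounded_linear.pos_bounded[OF bl] by blast
  have "norm (F (P y) - F (P z)) \<le> (\<bar>K\<bar> * B) * norm (y - z)" for y z
  proof -
    have "norm (F (P y) - F (P z)) \<le> K * norm (P y - P z)" by (intro lip P_in)
    also have "\<dots> \<le> \<bar>K\<bar> * norm (P (y - z))"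
      by (simp add: linear_diff[OF P] mult_right_mono)
    also have "\<dots> \<le> \<bar>K\<bar> * (norm (y - z) * B)" by (intro mult_left_mono B(2)) simp
    finally show ?thesis by (simp add: mult_ac)
  qed
  then obtain u where u0: "u 0 = x" and u: "\<And>t. (u has_vector_derivative F (P (u t))) (at t)"
    using global_solution_exists[of "\<lambda>y. F (P y)" "\<bar>K\<bar> * B" x] B(1) by auto
  have P_u: "P (u t) = u t" for t
  proof -
    have "P (F (P (u s))) = F (P (u s))" for s using F P_in by (intro P_id) blast
    then have "((\<lambda>s. P (u s) - u s) has_vector_derivative 0) (at s)" for s
      using has_vector_derivative_diff[OF bounded_linear.has_vector_derivative[OF bl u] u, of s] by simp
    then have "((\<lambda>s. P (u s) - u s) has_vector_derivative 0) (at s within UNIV)" for s by simp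
    then obtain k where "\<And>s. P (u s) - u s = k"
      using has_vector_derivative_zero_constant[of UNIV "\<lambda>s. P (u s) - u s"] by auto
    then have "P (u t) - u t = P (u 0) - u 0" by metis
    then show ?thesis using x by (simp add: u0 P_id)
  qed
  then have "ode_solution E F x u"
    using u u0 P_in unfolding ode_solution_def by metis
  then show ?thesis by blast
qed

lemma ode_solution_flow:
  fixes E :: "'e::euclidean_space set"
  assumes "subspace E" and "F \<in> E \<rightarrow> E" and "x \<in> E"
    and lip: "\<And>x y. x \<in> E \<Longrightarrow> y \<in> E \<Longrightarrow> norm (F x - F y) \<le> K * norm (x - y)"
  shows "ode_solution E F x (\<lambda>t. flow E F t x)"
  unfolding flow_def eta_contract_eq
  using ode_solution_exists[OF assms] ode_solution_unique[OF lip] theI'[of "ode_solution E F x"]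
  by blast

lemma flow_eqI:
  fixes E :: "'e::euclidean_space set"
  assumes lip: "\<And>x y. x \<in> E \<Longrightarrow> y \<in> E \<Longrightarrow> norm (F x - F y) \<le> K * norm (x - y)"
    and "ode_solution E F x u"
  shows "flow E F t x = u t"
  unfolding flow_def using ode_solution_unique[OF lip] assms(2) the_equality by metis

section \<open>Vector fields with bounded derivatives are Lipschitz\<close>

lemma linear_map_on_lipschitz:
  fixes E :: "'e::euclidean_space set" and D :: "'f::euclidean_space set"
  assumes "subspace E" and "linear_map_on E D f"
  shows "\<exists>K. \<forall>x\<in>E. \<forall>y\<in>E. norm (f x - f y) \<le> K * norm (x - y)"
proof -
  obtain g where g: "linear g" "\<And>x. x \<in> E \<Longrightarrow> g x = f x"
    using linear_map_on_extension[OF assms] by blast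
  then have "bounded_linear g" by (simp add: linear_conv_bounded_linear)
  then obtain K where K: "\<And>x. norm (g x) \<le> K * norm x"
    using bounded_linear.nonneg_bounded by (metis mult.commute)
  have "norm (f x - f y) \<le> K * norm (x - y)" if "x \<in> E" "y \<in> E" for x y
    using K[of "x - y"] that by (simp add: linear_diff[OF g(1)] g(2))
  then show ?thesis by blast
qed

text \<open>A derivative within \<open>E\<close> is only determined on \<open>E\<close>, and its values elsewhere admit no bound. Composing it
with a linear retraction onto \<open>E\<close> gives another derivative within \<open>E\<close>, whose operator norm is
bounded by the sum of the bounds in finitely many directions; the mean value inequality applies to
that one.\<close>

lemma bounded_derivatives_lipschitz:
  fixes E :: "'e::euclidean_space set"
  assumes E: "subspace E" and diff: "\<And>x. x \<in> E \<Longrightarrow> f differentiable (at x within E)"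
    and bounded: "\<And>v. v \<in> E \<Longrightarrow> bounded (directional_derivative E f v ` E)"
  shows "\<exists>K. \<forall>x\<in>E. \<forall>y\<in>E. norm (f x - f y) \<le> K * norm (x - y)"
proof -
  obtain P where P: "linear P" and P_in: "\<And>x. P x \<in> E" and P_id: "\<And>x. x \<in> E \<Longrightarrow> P x = x"
    using linear_retraction[OF E] by metis
  have bl: "bounded_linear P" using P by (simp add: linear_conv_bounded_linear)
  define D where "D x = frechet_derivative f (at x within E)" for x
  have D: "(f has_derivative D x) (at x within E)" if "x \<in> E" for x
    using diff[OF that] unfolding D_def frechet_derivative_works .
  have blD: "bounded_linear (D x)" if "x \<in> E" for x
    using D[OF that] by (rule has_derivative_bounded_linear)
  have "\<exists>M. \<forall>x\<in>E. norm (D x (P b)) \<le> M" for b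
    using bounded[OF P_in[of b]] unfolding bounded_iff directional_derivative_def D_def by simp
  then obtain M where M: "\<And>b x. x \<in> E \<Longrightarrow> norm (D x (P b)) \<le> M b" by metis
  define K where "K = (\<Sum>b\<in>Basis. M b)"
  have "norm (f x - f y) \<le> K * norm (x - y)" if "x \<in> E" "y \<in> E" for x y
  proof (rule differentiable_bound)
    show "convex E" by (rule subspace_imp_convex[OF E])
    show "x \<in> E" "y \<in> E" by fact+
    show "(f has_derivative (\<lambda>v. D z (P v))) (at z within E)" if z: "z \<in> E" for z
    proof -
      have "\<forall>\<^sub>F w in at z within E. P (w - z) = w - z"
        unfolding eventually_at_filter using z by (auto intro!: always_eventually P_id subspace_diff[OF E])
      with D[OF z] bounded_linear_compose[OF blD[OF z] bl] show ?thesis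
        unfolding has_derivative_within
        by (auto elim!: Lim_transform_eventually elim: eventually_mono)
    qed
    show "onorm (\<lambda>v. D z (P v)) \<le> K" if z: "z \<in> E" for z
    proof (rule onorm_le)
      fix v
      have lin: "linear (\<lambda>v. D z (P v))"
        using bounded_linear_compose[OF blD[OF z] bl] by (rule bounded_linear.linear)
      have "D z (P v) = D z (P (\<Sum>b\<in>Basis. (v \<bullet> b) *\<^sub>R b))" by (simp only: euclidean_representation)
      also have "\<dots> = (\<Sum>b\<in>Basis. (v \<bullet> b) *\<^sub>R D z (P b))"
        by (simp add: linear_sum[OF lin] linear_scale[OF lin])
      also have "norm \<dots> \<le> (\<Sum>b\<in>Basis. M b * norm v)"
      proof (rule sum_norm_le)
        fix b :: 'e assume "b \<in> Basis"
        then have "\<bar>v \<bullet> b\<bar> * norm (D z (P b)) \<le> norm v * M b"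
          by (intro mult_mono Basis_le_norm M z) auto
        then show "norm ((v \<bullet> b) *\<^sub>R D z (P b)) \<le> M b * norm v" by (simp add: mult.commute)
      qed
      finally show "norm (D z (P v)) \<le> K * norm v" by (simp add: K_def sum_distrib_right)
    qed
  qed
  then show ?thesis by blast
qed

text \<open>The first derivatives of \<open>F - L\<close> are bounded in every direction, so \<open>F - L\<close> is Lipschitz, and so is
the linear map \<open>L\<close>.\<close>

lemma center_manifold_hyps_lipschitz:
  fixes E :: "'e::euclidean_space set"
  assumes E: "subspace E" and L: "linear_map_on E E L" and "k \<ge> 1"
    and F: "center_manifold_hyps k E L \<epsilon> F"
  obtains K where "\<And>x y. x \<in> E \<Longrightarrow> y \<in> E \<Longrightarrow> norm (F x - F y) \<le> K * norm (x - y)"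
proof -
  obtain l where k: "k = Suc l" using \<open>k \<ge> 1\<close> by (cases k) auto
  obtain M where M: "linear M" and agree: "\<And>x. x \<in> E \<Longrightarrow> M x = L x"
    using linear_map_on_extension[OF E L] by blast
  have "(\<lambda>x. F x - L x) differentiable (at x within E)" if x: "x \<in> E" for x
  proof -
    have "F differentiable (at x within E)"
      using F x unfolding center_manifold_hyps_def k by simp
    moreover have "M differentiable (at x within E)"
      using M by (simp add: linear_imp_differentiable)
    ultimately have "(\<lambda>x. F x - M x) differentiable (at x within E)" by (rule differentiable_diff)
    then show ?thesis
      by (rule differentiable_transform_within[of _ _ _ 1]) (simp_all add: x agree)
  qed
  moreover have "bounded (directional_derivative E (\<lambda>x. F x - L x) v ` E)" if "v \<in> E" for v
  proof -
    have "set [v] \<subseteq> E \<and> length [v] \<le> k" using that k by simp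
    then have "bounded (iterated_derivative E [v] (\<lambda>x. F x - L x) ` E)"
      using F unfolding center_manifold_hyps_def bounded_derivatives_on_def by blast
    then show ?thesis by simp
  qed
  ultimately obtain K1 where K1: "\<forall>x\<in>E. \<forall>y\<in>E. norm ((F x - L x) - (F y - L y)) \<le> K1 * norm (x - y)"
    using bounded_derivatives_lipschitz[OF E, of "\<lambda>x. F x - L x"] by blast
  obtain K2 where K2: "\<forall>x\<in>E. \<forall>y\<in>E. norm (L x - L y) \<le> K2 * norm (x - y)"
    using linear_map_on_lipschitz[OF E L] by blast
  have "norm (F x - F y) \<le> (K1 + K2) * norm (x - y)" if "x \<in> E" "y \<in> E" for x y
  proof -
    have "F x - F y = ((F x - L x) - (F y - L y)) + (L x - L y)" by simp
    then have "norm (F x - F y) \<le> norm ((F x - L x) - (F y - L y)) + norm (L x - L y)"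
      by (metis norm_triangle_ineq)
    also have "\<dots> \<le> K1 * norm (x - y) + K2 * norm (x - y)"
      using K1 K2 that by (intro add_mono) auto
    finally show ?thesis by (simp add: algebra_simps)
  qed
  then show thesis by (rule that)
qed

section \<open>The center manifold of a single vector field\<close>

locale center_manifold_setting =
  fixes k :: nat and E :: "'e::euclidean_space set" and L :: "'e \<Rightarrow> 'e" and \<epsilon> :: real and F :: "'e \<Rightarrow> 'e"
  assumes k: "k \<ge> 1" and E: "subspace E" and L: "linear_map_on E E L"
    and const: "center_manifold_constant k E L \<epsilon>" and hyps: "center_manifold_hyps k E L \<epsilon> F"
begin

abbreviation "center \<equiv> center_subspace E L"
abbreviation "hyperbolic \<equiv> hyperbolic_subspace E L"
abbreviation "\<pi>\<^sub>c \<equiv> center_projection E L"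
abbreviation "\<pi>\<^sub>h \<equiv> hyperbolic_projection E L"
abbreviation "\<Phi> \<equiv> flow E F"
abbreviation "\<phi> \<equiv> center_manifold_map k E L F"
abbreviation "M \<equiv> center_manifold k E L F"

lemma F_in: "x \<in> E \<Longrightarrow> F x \<in> E"
  using hyps by (auto simp: center_manifold_hyps_def)

lemma lipschitz: obtains K where "\<And>x y. x \<in> E \<Longrightarrow> y \<in> E \<Longrightarrow> norm (F x - F y) \<le> K * norm (x - y)"
  using center_manifold_hyps_lipschitz[OF E L k hyps] by blast

lemma subspace_center: "subspace center"
  by (simp add: center_subspace_eq subspace_spectral_subspace)

lemma center_subset: "center \<subseteq> E" and hyperbolic_subset: "hyperbolic \<subseteq> E"
  by (simp_all add: center_subspace_eq hyperbolic_subspace_eq spectral_subspace_subset[OF E])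

lemma
  assumes "x \<in> E"
  shows center_projection_in: "\<pi>\<^sub>c x \<in> center"
    and hyperbolic_projection_in: "\<pi>\<^sub>h x \<in> hyperbolic"
  using theI'[OF center_hyperbolic_decomposition[OF E L assms]]
  by (simp_all add: center_projection_def hyperbolic_projection_def)

lemma center_projection_eqI:
  assumes y: "y \<in> center" and z: "z \<in> hyperbolic"
  shows "\<pi>\<^sub>c (y + z) = y"
proof -
  have "y + z \<in> E"
    using y z center_subset hyperbolic_subset by (auto intro: subspace_add[OF E])
  from the1_equality[OF center_hyperbolic_decomposition[OF E L this], of y] y z show ?thesis
    unfolding center_projection_def by simp
qed

lemma solution_flow:
  assumes "x \<in> E" shows "ode_solution E F x (\<lambda>t. \<Phi> t x)"
proof -
  obtain K where K: "\<And>x y. x \<in> E \<Longrightarrow> y \<in> E \<Longrightarrow> norm (F x - F y) \<le> K * norm (x - y)"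
    using lipschitz by blast
  show ?thesis by (rule ode_solution_flow[OF E _ assms K]) (use F_in in auto)
qed

lemma flow_in: "x \<in> E \<Longrightarrow> \<Phi> t x \<in> E"
  using solution_flow by (simp add: ode_solution_def)

lemma flow_unique:
  assumes "ode_solution E F x u" shows "\<Phi> t x = u t"
proof -
  obtain K where K: "\<And>x y. x \<in> E \<Longrightarrow> y \<in> E \<Longrightarrow> norm (F x - F y) \<le> K * norm (x - y)"
    using lipschitz by blast
  show ?thesis by (rule flow_eqI[OF K assms])
qed

lemma center_manifold_eq: "M = {x \<in> E. bounded (range (\<lambda>t. \<pi>\<^sub>h (\<Phi> t x)))}"
  using is_center_manifold_map_center_manifold_map[OF const hyps]
  by (simp add: center_manifold_def is_center_manifold_map_def)

lemma center_manifold_map_in: "x \<in> center \<Longrightarrow> \<phi> x \<in> hyperbolic"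
  using is_center_manifold_map_center_manifold_map[OF const hyps]
  by (auto simp: is_center_manifold_map_def)

lemma graph_in_center_manifold: "x \<in> center \<Longrightarrow> x + \<phi> x \<in> M"
  by (auto simp: center_manifold_def center_graph_def)

text \<open>A point of the center manifold is determined by its center component.\<close>

lemma center_manifold_map_eqI:
  assumes y: "y \<in> center" and z: "z \<in> hyperbolic" and "y + z \<in> M"
  shows "\<phi> y = z"
proof -
  obtain x where x: "y + z = x + \<phi> x" "x \<in> center"
    using \<open>y + z \<in> M\<close> by (auto simp: center_manifold_def center_graph_def)
  have "y = x"
    using center_projection_eqI[OF y z] center_projection_eqI[OF x(2) center_manifold_map_in[OF x(2)]] x(1)
    by simp
  with x(1) show ?thesis by simp
qed

lemma F_graph_in: "x \<in> center \<Longrightarrow> F (x + \<phi> x) \<in> E"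
  using center_manifold_map_in center_subset hyperbolic_subset by (intro F_in subspace_add[OF E]) auto

lemma center_reduction_in: "x \<in> center \<Longrightarrow> center_reduction k E L F x \<in> center"
  unfolding center_reduction_def by (intro center_projection_in F_graph_in)

end

section \<open>Linear maps between vector fields\<close>

text \<open>The situation at a single arrow of the quiver: a linear map that intertwines the linear maps
and the vector fields at its two ends.\<close>

locale semiconjugacy =
  source: center_manifold_setting k E L \<epsilon> F + target: center_manifold_setting k E' L' \<epsilon>' F'
  for k :: nat and E :: "'e::euclidean_space set" and L \<epsilon> F
    and E' :: "'f::euclidean_space set" and L' \<epsilon>' F' +
  fixes R :: "'e \<Rightarrow> 'f"
  assumes R: "linear_map_on E E' R"
    and RL: "\<And>x. x \<in> E \<Longrightarrow> R (L x) = L' (R x)"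
    and RF: "\<And>x. x \<in> E \<Longrightarrow> R (F x) = F' (R x)"
begin

lemma R_in: "x \<in> E \<Longrightarrow> R x \<in> E'"
  using R by (auto simp: linear_map_on_def)

lemma R_add: "x \<in> E \<Longrightarrow> y \<in> E \<Longrightarrow> R (x + y) = R x + R y"
  using R by (auto simp: linear_map_on_def)

lemma R_spectral_subspace:
  assumes "x \<in> spectral_subspace E L S" shows "R x \<in> spectral_subspace E' L' S"
proof -
  obtain g where g: "linear g" "\<And>x. x \<in> E \<Longrightarrow> g x = R x"
    using linear_map_on_extension[OF source.E R] by blast
  have maps: "L \<in> E \<rightarrow> E" "L' \<in> E' \<rightarrow> E'"
    using source.L target.L by (simp_all add: linear_map_on_def)
  have "g ` spectral_subspace E L S \<subseteq> spectral_subspace E' L' S"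
    by (rule linear_image_spectral_subspace[OF source.E target.E g(1) _ maps
          linear_map_on_0[OF target.E target.L]])
      (use g(2) R_in RL maps in \<open>auto simp: Pi_iff\<close>)
  then show ?thesis
    using assms g(2) spectral_subspace_subset[OF source.E] by fastforce
qed

lemma R_center: "x \<in> source.center \<Longrightarrow> R x \<in> target.center"
  and R_hyperbolic: "x \<in> source.hyperbolic \<Longrightarrow> R x \<in> target.hyperbolic"
  by (simp_all add: center_subspace_eq hyperbolic_subspace_eq R_spectral_subspace)

lemma
  assumes x: "x \<in> E"
  shows R_center_projection: "R (source.\<pi>\<^sub>c x) = target.\<pi>\<^sub>c (R x)"
    and R_hyperbolic_projection: "R (source.\<pi>\<^sub>h x) = target.\<pi>\<^sub>h (R x)"
proof -
  let ?c = "source.\<pi>\<^sub>c x" and ?h = "source.\<pi>\<^sub>h x"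
  have c: "?c \<in> source.center" and h: "?h \<in> source.hyperbolic"
    by (rule source.center_projection_in[OF x] source.hyperbolic_projection_in[OF x])+
  have "x = ?c + ?h" by (simp add: hyperbolic_projection_def)
  then have split: "R x = R ?c + R ?h"
    using c h source.center_subset source.hyperbolic_subset R_add by (metis subsetD)
  then show "R ?c = target.\<pi>\<^sub>c (R x)"
    using target.center_projection_eqI[OF R_center[OF c] R_hyperbolic[OF h]] by simp
  with split show "R ?h = target.\<pi>\<^sub>h (R x)"
    unfolding hyperbolic_projection_def[of E'] by (metis add_diff_cancel_left')
qed

text \<open>The image of a solution solves the equation for \<open>F'\<close>, so the claim follows from uniqueness.\<close>

lemma R_flow:
  assumes x: "x \<in> E" shows "R (source.\<Phi> t x) = target.\<Phi> t (R x)"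
proof -
  obtain g where g: "linear g" "\<And>x. x \<in> E \<Longrightarrow> g x = R x"
    using linear_map_on_extension[OF source.E R] by blast
  note sol = source.solution_flow[OF x]
  have "((\<lambda>t. source.\<Phi> t x) has_vector_derivative F (source.\<Phi> s x)) (at s)" for s
    using sol unfolding ode_solution_def by blast
  then have "((\<lambda>t. g (source.\<Phi> t x)) has_vector_derivative g (F (source.\<Phi> s x))) (at s)" for s
    using g(1) unfolding linear_conv_bounded_linear by (rule bounded_linear.has_vector_derivative[rotated])
  then have "((\<lambda>t. R (source.\<Phi> t x)) has_vector_derivative F' (R (source.\<Phi> s x))) (at s)" for s
    using source.flow_in[OF x] by (simp add: g(2) RF source.F_in)
  moreover have "source.\<Phi> 0 x = x" using sol by (simp add: ode_solution_def)
  ultimately have "ode_solution E' F' (R x) (\<lambda>t. R (source.\<Phi> t x))"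
    using R_in source.flow_in[OF x] by (simp add: ode_solution_def)
  from target.flow_unique[OF this] show ?thesis by simp
qed

text \<open>The hyperbolic part of the orbit of \<open>R x\<close> is the image under \<open>R\<close> of that of \<open>x\<close>, and bounded
linear maps preserve bounded sets.\<close>

lemma R_center_manifold:
  assumes "x \<in> source.M" shows "R x \<in> target.M"
proof -
  have x: "x \<in> E" and b: "bounded (range (\<lambda>t. source.\<pi>\<^sub>h (source.\<Phi> t x)))"
    using assms by (simp_all add: source.center_manifold_eq)
  obtain g where g: "linear g" "\<And>x. x \<in> E \<Longrightarrow> g x = R x"
    using linear_map_on_extension[OF source.E R] by blast
  have "source.\<pi>\<^sub>h (source.\<Phi> t x) \<in> E" for t
    using source.hyperbolic_projection_in[OF source.flow_in[OF x]] source.hyperbolic_subset by blast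
  then have "target.\<pi>\<^sub>h (target.\<Phi> t (R x)) = g (source.\<pi>\<^sub>h (source.\<Phi> t x))" for t
    by (simp add: g(2) R_hyperbolic_projection[OF source.flow_in[OF x]] R_flow[OF x])
  moreover have "bounded (g ` range (\<lambda>t. source.\<pi>\<^sub>h (source.\<Phi> t x)))"
    using g(1) by (intro bounded_linear_image[OF b]) (simp add: linear_conv_bounded_linear)
  ultimately show ?thesis
    using R_in[OF x] by (simp add: target.center_manifold_eq image_image)
qed

text \<open>Both \<open>R x + R (\<phi> x)\<close> and \<open>R x + \<phi>' (R x)\<close> are points of the target center manifold over \<open>R x\<close>.\<close>

lemma R_center_manifold_map:
  assumes x: "x \<in> source.center"
  shows "R (source.\<phi> x) = target.\<phi> (R x)"
proof (rule target.center_manifold_map_eqI[symmetric])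
  note h = source.center_manifold_map_in[OF x]
  show "R x \<in> target.center" by (rule R_center[OF x])
  show "R (source.\<phi> x) \<in> target.hyperbolic" by (rule R_hyperbolic[OF h])
  have in_E: "x \<in> E" "source.\<phi> x \<in> E"
    using x h source.center_subset source.hyperbolic_subset by auto
  show "R x + R (source.\<phi> x) \<in> target.M"
    unfolding R_add[OF in_E, symmetric]
    by (rule R_center_manifold[OF source.graph_in_center_manifold[OF x]])
qed

lemma R_center_reduction:
  assumes x: "x \<in> source.center"
  shows "R (center_reduction k E L F x) = center_reduction k E' L' F' (R x)"
proof -
  let ?y = "x + source.\<phi> x"
  have in_E: "x \<in> E" "source.\<phi> x \<in> E"
    using x source.center_manifold_map_in[OF x] source.center_subset source.hyperbolic_subset by auto
  then have y: "?y \<in> E" by (rule subspace_add[OF source.E])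
  have "R (source.\<pi>\<^sub>c (F ?y)) = target.\<pi>\<^sub>c (R (F ?y))"
    by (rule R_center_projection[OF source.F_in[OF y]])
  also have "R (F ?y) = F' (R x + target.\<phi> (R x))"
    unfolding RF[OF y] R_add[OF in_E] R_center_manifold_map[OF x] ..
  finally show ?thesis by (simp add: center_reduction_def)
qed

end

section \<open>Equivariance of center manifold reduction\<close>

theorem theorem8p2:
  fixes Q :: "('v, 'a) pre_digraph"
    and E :: "'v \<Rightarrow> 'e::euclidean_space set"
    and R :: "'a \<Rightarrow> 'e \<Rightarrow> 'e"
    and L F :: "'v \<Rightarrow> 'e \<Rightarrow> 'e"
    and \<epsilon> :: "'v \<Rightarrow> real"
    and k :: nat
  assumes "fin_digraph Q"
    and "quiver_representation Q E R"
    and "k \<ge> 1"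
    and "\<And>v. v \<in> verts Q \<Longrightarrow> linear_map_on (E v) (E v) (L v)"
    and "\<And>v. v \<in> verts Q \<Longrightarrow> center_manifold_constant k (E v) (L v) (\<epsilon> v)"
    and "\<And>v. v \<in> verts Q \<Longrightarrow> center_manifold_hyps k (E v) (L v) (\<epsilon> v) (F v)"
    and "equivariant Q E R L"
    and "equivariant Q E R F"
  shows "(\<forall>a\<in>arcs Q.
            R a ` center_manifold k (E (tail Q a)) (L (tail Q a)) (F (tail Q a))
              \<subseteq> center_manifold k (E (head Q a)) (L (head Q a)) (F (head Q a))) \<and>
         subrepresentation Q E R (\<lambda>v. center_subspace (E v) (L v)) \<and>
         equivariant Q (\<lambda>v. center_subspace (E v) (L v)) R
           (\<lambda>v. center_reduction k (E v) (L v) (F v))"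
proof -
  interpret fin_digraph Q by fact
  have vertex: "center_manifold_setting k (E v) (L v) (\<epsilon> v) (F v)" if "v \<in> verts Q" for v
    using assms(2-6) that by unfold_locales (simp_all add: quiver_representation_def)
  have arc: "semiconjugacy k (E (tail Q a)) (L (tail Q a)) (\<epsilon> (tail Q a)) (F (tail Q a))
      (E (head Q a)) (L (head Q a)) (\<epsilon> (head Q a)) (F (head Q a)) (R a)" if "a \<in> arcs Q" for a
  proof (intro semiconjugacy.intro semiconjugacy_axioms.intro)
    show "linear_map_on (E (tail Q a)) (E (head Q a)) (R a)"
      using assms(2) that by (simp add: quiver_representation_def)
    show "R a (L (tail Q a) x) = L (head Q a) (R a x)" "R a (F (tail Q a) x) = F (head Q a) (R a x)"
      if "x \<in> E (tail Q a)" for x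
      using assms(7,8) \<open>a \<in> arcs Q\<close> that by (simp_all add: equivariant_def)
  qed (use that vertex in simp_all)
  have "R a ` center_manifold k (E (tail Q a)) (L (tail Q a)) (F (tail Q a))
      \<subseteq> center_manifold k (E (head Q a)) (L (head Q a)) (F (head Q a))" if "a \<in> arcs Q" for a
    using semiconjugacy.R_center_manifold[OF arc[OF that]] by (rule image_subsetI)
  moreover have "subrepresentation Q E R (\<lambda>v. center_subspace (E v) (L v))"
    unfolding subrepresentation_def
    using center_manifold_setting.subspace_center[OF vertex] center_manifold_setting.center_subset[OF vertex]
      semiconjugacy.R_center[OF arc]
    by (simp add: image_subset_iff)
  moreover have "equivariant Q (\<lambda>v. center_subspace (E v) (L v)) R
      (\<lambda>v. center_reduction k (E v) (L v) (F v))"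
    unfolding equivariant_def
    using center_manifold_setting.center_reduction_in[OF vertex] semiconjugacy.R_center_reduction[OF arc]
    by simp
  ultimately show ?thesis by simp
qed

end
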